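(* Let $T$ be a finite dimensional semisimple Lie triple system over an algebraically closed field of characteristic $0$, and let $S$ be the maximal system of quotients of $T$. Then $S=T$.
   Context: A Lie triple system (LTS) over a field is a vector space $T$ with a trilinear map $(x,y,z)\mapsto[x,y,z]$ such that $[x,x,z]=0$, $[x,y,z]+[y,z,x]+[z,x,y]=0$, and $[u,v,[x,y,z]]=[[u,v,x],y,z]+[x,[u,v,y],z]+[x,y,[u,v,z]]$ for all $x,y,z,u,v\in T$. A subsystem of $T$ is a subspace $I$ with $[I,I,I]\subseteq I$; an ideal of $T$ is a subspace $I$ with $[I,T,T]\subseteq I$. Brackets of subspaces denote the linear span of the corresponding brackets of elements; an element in such a bracket stands for itself. An ideal $I$ of $T$ is solvable if $I^{(k)}=0$ for some $k$, where $I^{(0)}=I$ and $I^{(n+1)}=[T,I^{(n)},I^{(n)}]$; the solvable radical $R(T)$ of a finite dimensional LTS $T$ is its largest solvable ideal, and $T$ is semisimple if $R(T)=0$. Let $T$ be a subsystem of an LTS $S$. Define $R(x,y)(z)=[z,x,y]$ for $x,y,z\in S$. For $s\in S$, let ${}_T(s)$ be the linear span in $S$ of $s$ and all elements $R(x_1,y_1)\cdots R(x_n,y_n)(s)$ with $n\in\mathbb{N}$ and $x_i,y_i\in T$, and let $(T:s)=\{x\in T\mid [x,T,{}_T(s)]+[x,{}_T(s),T]\subseteq T\}$. $S$ is a system of quotients of $T$ if for all $s,s'\in S$ with $s\neq 0$ there exist $x,y\in T$ such that $[s,x,y]\neq 0$ and ($x\in (T:s')$ or $y\in (T:s')$). The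 maximal system of quotients of $T$ is a system of quotients $S$ of $T$ such that for every system of quotients $S'$ of $T$ there exists a monomorphism of Lie triple systems $S'\to S$ which is the identity on $T$. *)

theory Defs
  imports
    "HOL-Library.Set_Algebras"
    "HOL-Computational_Algebra.Polynomial"
begin

text \<open>
  A Lie triple system is given by a subspace of an ambient vector space together with a bracket;
  the values of the bracket outside the carrier are irrelevant.
\<close>

locale lie_triple_system = vector_space scale
  for scale :: "'k::field \<Rightarrow> 'v::ab_group_add \<Rightarrow> 'v" +
  fixes carr :: "'v set" and br :: "'v \<Rightarrow> 'v \<Rightarrow> 'v \<Rightarrow> 'v"
  assumes subspace_carr: "subspace carr"
    and br_closed: "\<lbrakk>x \<in> carr; y \<in> carr; z \<in> carr\<rbrakk> \<Longrightarrow> br x y z \<in> carr"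
    and br_add1: "\<lbrakk>x \<in> carr; x' \<in> carr; y \<in> carr; z \<in> carr\<rbrakk>
      \<Longrightarrow> br (x + x') y z = br x y z + br x' y z"
    and br_add2: "\<lbrakk>x \<in> carr; y \<in> carr; y' \<in> carr; z \<in> carr\<rbrakk>
      \<Longrightarrow> br x (y + y') z = br x y z + br x y' z"
    and br_add3: "\<lbrakk>x \<in> carr; y \<in> carr; z \<in> carr; z' \<in> carr\<rbrakk>
      \<Longrightarrow> br x y (z + z') = br x y z + br x y z'"
    and br_scale1: "\<lbrakk>x \<in> carr; y \<in> carr; z \<in> carr\<rbrakk> \<Longrightarrow> br (scale c x) y z = scale c (br x y z)"
    and br_scale2: "\<lbrakk>x \<in> carr; y \<in> carr; z \<in> carr\<rbrakk> \<Longrightarrow> br x (scale c y) z = scale c (br x y z)"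
    and br_scale3: "\<lbrakk>x \<in> carr; y \<in> carr; z \<in> carr\<rbrakk> \<Longrightarrow> br x y (scale c z) = scale c (br x y z)"
    and br_alternating: "\<lbrakk>x \<in> carr; z \<in> carr\<rbrakk> \<Longrightarrow> br x x z = 0"
    and br_cyclic: "\<lbrakk>x \<in> carr; y \<in> carr; z \<in> carr\<rbrakk> \<Longrightarrow> br x y z + br y z x + br z x y = 0"
    and br_derivation: "\<lbrakk>u \<in> carr; v \<in> carr; x \<in> carr; y \<in> carr; z \<in> carr\<rbrakk>
      \<Longrightarrow> br u v (br x y z) = br (br u v x) y z + br x (br u v y) z + br x y (br u v z)"
begin

definition finite_dimensional :: bool where
  "finite_dimensional \<longleftrightarrow> (\<exists>B. finite B \<and> span B = carr)"

definition bracket :: "'v set \<Rightarrow> 'v set \<Rightarrow> 'v set \<Rightarrow> 'v set" where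
  "bracket A B C = span {br a b c | a b c. a \<in> A \<and> b \<in> B \<and> c \<in> C}"

definition subsystem :: "'v set \<Rightarrow> bool" where
  "subsystem I \<longleftrightarrow> subspace I \<and> I \<subseteq> carr \<and> bracket I I I \<subseteq> I"

definition lts_ideal :: "'v set \<Rightarrow> bool" where
  "lts_ideal I \<longleftrightarrow> subspace I \<and> I \<subseteq> carr \<and> bracket I carr carr \<subseteq> I"

primrec derived :: "'v set \<Rightarrow> nat \<Rightarrow> 'v set" where
  "derived I 0 = I"
| "derived I (Suc n) = bracket carr (derived I n) (derived I n)"

definition solvable_ideal :: "'v set \<Rightarrow> bool" where
  "solvable_ideal I \<longleftrightarrow> lts_ideal I \<and> (\<exists>k. derived I k = {0})"

text \<open>The largest solvable ideal with respect to inclusion; it exists in finite dimension,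
  and only there is the definition meaningful.\<close>

definition solvable_radical :: "'v set" where
  "solvable_radical = (GREATEST I. solvable_ideal I)"

definition semisimple :: bool where
  "semisimple \<longleftrightarrow> solvable_radical = {0}"

definition R :: "'v \<Rightarrow> 'v \<Rightarrow> 'v \<Rightarrow> 'v" where
  "R x y z = br z x y"

text \<open>The subspace \<open>\<^sub>T(s)\<close>: the list \<open>[(x\<^sub>1,y\<^sub>1), \<dots>, (x\<^sub>n,y\<^sub>n)]\<close> contributes
  \<open>R(x\<^sub>1,y\<^sub>1) \<cdots> R(x\<^sub>n,y\<^sub>n)(s)\<close>, and the empty list contributes \<open>s\<close> itself.\<close>

definition R_span :: "'v set \<Rightarrow> 'v \<Rightarrow> 'v set" where
  "R_span T s = span {foldr (\<lambda>(x, y). R x y) ps s | ps. set ps \<subseteq> T \<times> T}"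

text \<open>The set \<open>(T : s)\<close>; the sum below is the sum of subspaces.\<close>

definition colon :: "'v set \<Rightarrow> 'v \<Rightarrow> 'v set" where
  "colon T s = {x \<in> T. bracket {x} T (R_span T s) + bracket {x} (R_span T s) T \<subseteq> T}"

end

text \<open>\<open>(S, brS)\<close> is a system of quotients of the Lie triple system \<open>(T, brT)\<close>.\<close>

definition system_of_quotients ::
  "('k::field \<Rightarrow> 'v::ab_group_add \<Rightarrow> 'v) \<Rightarrow> 'v set \<Rightarrow> ('v \<Rightarrow> 'v \<Rightarrow> 'v \<Rightarrow> 'v)
    \<Rightarrow> 'v set \<Rightarrow> ('v \<Rightarrow> 'v \<Rightarrow> 'v \<Rightarrow> 'v) \<Rightarrow> bool" where
  "system_of_quotients scale T brT S brS \<longleftrightarrow>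
    lie_triple_system scale S brS \<and>
    lie_triple_system.subsystem scale S brS T \<and>
    (\<forall>x\<in>T. \<forall>y\<in>T. \<forall>z\<in>T. brS x y z = brT x y z) \<and>
    (\<forall>s\<in>S. \<forall>s'\<in>S. s \<noteq> 0 \<longrightarrow>
      (\<exists>x\<in>T. \<exists>y\<in>T. brS s x y \<noteq> 0 \<and>
        (x \<in> lie_triple_system.colon scale brS T s' \<or>
         y \<in> lie_triple_system.colon scale brS T s')))"

definition lts_monomorphism ::
  "('k::field \<Rightarrow> 'v::ab_group_add \<Rightarrow> 'v) \<Rightarrow> 'v set \<Rightarrow> ('v \<Rightarrow> 'v \<Rightarrow> 'v \<Rightarrow> 'v)
    \<Rightarrow> 'v set \<Rightarrow> ('v \<Rightarrow> 'v \<Rightarrow> 'v \<Rightarrow> 'v) \<Rightarrow> ('v \<Rightarrow> 'v) \<Rightarrow> bool" where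
  "lts_monomorphism scale A brA B brB f \<longleftrightarrow>
    f ` A \<subseteq> B \<and> inj_on f A \<and>
    (\<forall>x\<in>A. \<forall>y\<in>A. f (x + y) = f x + f y) \<and>
    (\<forall>c. \<forall>x\<in>A. f (scale c x) = scale c (f x)) \<and>
    (\<forall>x\<in>A. \<forall>y\<in>A. \<forall>z\<in>A. f (brA x y z) = brB (f x) (f y) (f z))"

text \<open>The competing systems of quotients \<open>(S', brS')\<close> are those whose underlying vector space lies
  in the same ambient space as \<open>T\<close> and \<open>S\<close>; their brackets are unrelated to \<open>brS\<close> outside \<open>T\<close>. Up to
  isomorphism over \<open>T\<close>, this captures any given system of quotients once the (arbitrary) ambient
  space is large enough.\<close>

definition maximal_system_of_quotients ::
  "('k::field \<Rightarrow> 'v::ab_group_add \<Rightarrow> 'v) \<Rightarrow> 'v set \<Rightarrow> ('v \<Rightarrow> 'v \<Rightarrow> 'v \<Rightarrow> 'v)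
    \<Rightarrow> 'v set \<Rightarrow> ('v \<Rightarrow> 'v \<Rightarrow> 'v \<Rightarrow> 'v) \<Rightarrow> bool" where
  "maximal_system_of_quotients scale T brT S brS \<longleftrightarrow>
    system_of_quotients scale T brT S brS \<and>
    (\<forall>S' brS'. system_of_quotients scale T brT S' brS' \<longrightarrow>
      (\<exists>f. lts_monomorphism scale S' brS' S brS f \<and> (\<forall>t\<in>T. f t = t)))"

end

(*
  For a finite dimensional semisimple T the Killing form rho(u,v) = tr_T([-,u,v] + [-,v,u]) is
  nondegenerate.  Indeed its radical is an ideal; if it were not solvable, its derived series
  would stop at an ideal P = [T,P,P] orthogonal to T.  For X in the span h of the maps [a,b,-]
  with a in P, b in T, let E act on the generalized eigenspace of X for the eigenvalue l as
  phi(l), where phi is Q-linear with rational values.  E is a derivation, so the Killing form of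
  the standard embedding vanishes on (X,E); applying phi gives a vanishing sum of squares of the
  phi(l).  Hence every X in h is nilpotent, and Engel's theorem together with P = hP forces P = 0.

  Let now s be in a system of quotients S of T.  The colon (T:s) is an ideal of T.  If it were
  proper, a nonzero element of its orthogonal complement would annihilate it, contradicting the
  quotient condition; so [s,T,T], [T,s,T] and [T,T,s] lie in T.  Then rho(s,-) is defined on T
  and represented by some t in T, and invariance of rho gives [s-t,T,T] = 0.  By the quotient
  condition once more, s = t.
*)

theory Submission
  imports Defs "HOL-Library.Function_Algebras"
begin

subsection \<open>Traces and generalized eigenspaces\<close>

text \<open>Conjugating eigenvalues, the device for a Cartan-type criterion over the complex
  numbers, has no counterpart over the present field; \<open>\<phi>\<close> replaces it. Its
  additivity makes E a derivation, because eigenvalues add up under the bracket; its rational values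
  can be pulled out of \<open>\<phi>\<close> as scalars, which produces squares; and the order of
  the rationals makes a vanishing sum of squares trivial. Such an E is not known to be inner, so the
  Killing form has to vanish against all derivations. It does, because for X = [a,b,-] it collapses
  to -rho(a, E b), and a is orthogonal to everything.

  The standard embedding is never built as a Lie algebra. Its even part is the space of inner
  derivations, and only two traces occur: that of \<open>X \<circ> E\<close> on T and that of
  \<open>commutator X \<circ> commutator E\<close> on the even part. The second lives on a space of
  functions, hence the linear algebra for arbitrary vector spaces.

  For s outside T, rho(s,-) is a trace over T of maps built from s, so it makes sense only once
  these maps preserve T. This is why the colon is dealt with before the form.\<close>

definition (in vector_space) trace :: "'b set \<Rightarrow> ('b \<Rightarrow> 'b) \<Rightarrow> 'a" where
  "trace B f = (\<Sum>b\<in>B. representation B (f b) b)"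

definition (in vector_space) gen_eig :: "('b \<Rightarrow> 'b) \<Rightarrow> 'a \<Rightarrow> 'b set" where
  "gen_eig X l = {v. \<exists>n. ((\<lambda>v. X v - scale l v) ^^ n) v = 0}"

text \<open>The vector \<open>p(X) v\<close>, evaluated by Horner's rule.\<close>

definition (in vector_space) poly_act :: "('b \<Rightarrow> 'b) \<Rightarrow> 'a poly \<Rightarrow> 'b \<Rightarrow> 'b" where
  "poly_act X p = fold_coeffs (\<lambda>a f v. scale a v + X (f v)) p (\<lambda>_. 0)"

lemma (in vector_space_pair) trace_commute:
  assumes B1: "finite B1" "vs1.independent B1" and B2: "finite B2" "vs2.independent B2"
    and f: "Vector_Spaces.linear s1 s2 f" "f ` B1 \<subseteq> vs2.span B2"
    and g: "Vector_Spaces.linear s2 s1 g" "g ` B2 \<subseteq> vs1.span B1"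
  shows "vs1.trace B1 (g \<circ> f) = vs2.trace B2 (f \<circ> g)"
proof -
  interpret f: Vector_Spaces.linear s1 s2 f by fact
  interpret g: Vector_Spaces.linear s2 s1 g by fact
  have 1: "vs1.representation B1 (g (f b)) b =
      (\<Sum>c\<in>B2. vs2.representation B2 (f b) c * vs1.representation B1 (g c) b)" if "b \<in> B1" for b
  proof -
    have fb: "f b = (\<Sum>c\<in>B2. s2 (vs2.representation B2 (f b) c) c)"
      using f(2) that by (subst vs2.sum_representation_eq[OF B2(2) _ B2(1)]) auto
    have "g (f b) = (\<Sum>c\<in>B2. s1 (vs2.representation B2 (f b) c) (g c))"
      by (subst fb) (simp add: g.sum g.scale)
    also have "vs1.representation B1 \<dots> b
        = (\<Sum>c\<in>B2. vs1.representation B1 (s1 (vs2.representation B2 (f b) c) (g c)) b)"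
      using g(2) by (subst vs1.representation_sum[OF B1(2)]) (auto intro: vs1.span_scale)
    also have "\<dots> = (\<Sum>c\<in>B2. vs2.representation B2 (f b) c * vs1.representation B1 (g c) b)"
      using g(2) by (intro sum.cong refl) (subst vs1.representation_scale[OF B1(2)], auto)
    finally show ?thesis .
  qed
  have 2: "vs2.representation B2 (f (g c)) c =
      (\<Sum>b\<in>B1. vs1.representation B1 (g c) b * vs2.representation B2 (f b) c)" if "c \<in> B2" for c
  proof -
    have gc: "g c = (\<Sum>b\<in>B1. s1 (vs1.representation B1 (g c) b) b)"
      using g(2) that by (subst vs1.sum_representation_eq[OF B1(2) _ B1(1)]) auto
    have "f (g c) = (\<Sum>b\<in>B1. s2 (vs1.representation B1 (g c) b) (f b))"
      by (subst gc) (simp add: f.sum f.scale)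
    also have "vs2.representation B2 \<dots> c
        = (\<Sum>b\<in>B1. vs2.representation B2 (s2 (vs1.representation B1 (g c) b) (f b)) c)"
      using f(2) by (subst vs2.representation_sum[OF B2(2)]) (auto intro: vs2.span_scale)
    also have "\<dots> = (\<Sum>b\<in>B1. vs1.representation B1 (g c) b * vs2.representation B2 (f b) c)"
      using f(2) by (intro sum.cong refl) (subst vs2.representation_scale[OF B2(2)], auto)
    finally show ?thesis .
  qed
  have "vs1.trace B1 (g \<circ> f)
      = (\<Sum>b\<in>B1. \<Sum>c\<in>B2. vs2.representation B2 (f b) c * vs1.representation B1 (g c) b)"
    unfolding vs1.trace_def by (intro sum.cong refl) (simp add: 1)
  also have "\<dots> = (\<Sum>c\<in>B2. \<Sum>b\<in>B1. vs1.representation B1 (g c) b * vs2.representation B2 (f b) c)"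
    by (subst sum.swap) (simp add: mult.commute)
  also have "\<dots> = vs2.trace B2 (f \<circ> g)"
    unfolding vs2.trace_def by (intro sum.cong refl) (simp add: 2)
  finally show ?thesis .
qed

context vector_space
begin

lemma linearI:
  assumes "\<And>x y. f (x + y) = f x + f y" "\<And>c x. f (scale c x) = scale c (f x)"
  shows "Vector_Spaces.linear scale scale f"
  using assms by (simp add: Vector_Spaces.linear_iff vector_space_axioms)

lemma trace_cong: "(\<And>b. b \<in> B \<Longrightarrow> f b = g b) \<Longrightarrow> trace B f = trace B g"
  by (simp add: trace_def)

lemma trace_add:
  assumes "independent B" "f ` B \<subseteq> span B" "g ` B \<subseteq> span B"
  shows "trace B (\<lambda>v. f v + g v) = trace B f + trace B g"
proof -
  have "representation B (f b + g b) b = representation B (f b) b + representation B (g b) b"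
    if "b \<in> B" for b
    using assms that by (subst representation_add) auto
  then show ?thesis by (simp add: trace_def sum.distrib)
qed

lemma trace_diff:
  assumes "independent B" "f ` B \<subseteq> span B" "g ` B \<subseteq> span B"
  shows "trace B (\<lambda>v. f v - g v) = trace B f - trace B g"
proof -
  have "representation B (f b - g b) b = representation B (f b) b - representation B (g b) b"
    if "b \<in> B" for b
    using assms that by (subst representation_diff) auto
  then show ?thesis by (simp add: trace_def sum_subtractf)
qed

lemma trace_scale:
  assumes "independent B" "f ` B \<subseteq> span B"
  shows "trace B (\<lambda>v. scale c (f v)) = c * trace B f"
proof -
  have "representation B (scale c (f b)) b = c * representation B (f b) b" if "b \<in> B" for b
    using assms that by (subst representation_scale) auto
  then show ?thesis by (simp add: trace_def sum_distrib_left)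
qed

text \<open>The identity, read as a map between the spans of the two bases, is one of the factors in
  \<open>trace_commute\<close>.\<close>

lemma trace_basis:
  assumes "finite B" "independent B" "finite C" "independent C" "span B = span C"
    "Vector_Spaces.linear scale scale f" "f ` span B \<subseteq> span B"
  shows "trace B f = trace C f"
proof -
  interpret vector_space_pair scale scale ..
  have "trace B (f \<circ> id) = trace C (id \<circ> f)"
  proof (rule trace_commute)
    show "Vector_Spaces.linear scale scale id" by (rule linearI) auto
    show "id ` B \<subseteq> span C" using assms span_superset[of B] by auto
    show "f ` C \<subseteq> span B" using assms span_superset[of C] by auto
  qed (use assms in auto)
  then show ?thesis by simp
qed

lemma linear_shift:
  assumes "Vector_Spaces.linear scale scale X"
  shows "Vector_Spaces.linear scale scale (\<lambda>v. X v - scale l v)"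
proof -
  interpret X: Vector_Spaces.linear scale scale X by fact
  show ?thesis by (rule linearI) (auto simp: X.add X.scale algebra_simps)
qed

lemma linear_funpow:
  assumes "Vector_Spaces.linear scale scale X"
  shows "Vector_Spaces.linear scale scale (X ^^ n)"
proof (induction n)
  case 0
  show ?case by (rule linearI) auto
next
  case (Suc n)
  interpret X: Vector_Spaces.linear scale scale X by fact
  interpret Xn: Vector_Spaces.linear scale scale "X ^^ n" by fact
  show ?case by (rule linearI) (auto simp: X.add X.scale Xn.add Xn.scale)
qed

lemma funpow_closed: "f ` A \<subseteq> A \<Longrightarrow> x \<in> A \<Longrightarrow> (f ^^ n) x \<in> A"
  by (induction n) auto

text \<open>\<open>X\<close> is triangularized by a basis of eigenvectors of \<open>E\<close>. A
  maximal family with invariant span is taken; if some generalized eigenvector \<open>g\<close> is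
  missing from the span, the last vector outside it in the chain \<open>g, (X - m) g, ...\<close>
  can be added, because \<open>X\<close> maps this vector to \<open>m\<close> times itself plus an
  element of the span.\<close>

lemma trace_triangular:
  assumes B: "finite B" "independent B"
    and X: "Vector_Spaces.linear scale scale X" "X ` span B \<subseteq> span B"
    and E: "Vector_Spaces.linear scale scale E"
    and comm: "\<And>v. v \<in> span B \<Longrightarrow> X (E v) = E (X v)"
    and G: "G \<subseteq> span B" "B \<subseteq> span G"
    and eig: "\<And>g. g \<in> G \<Longrightarrow> \<exists>l. g \<in> gen_eig X l \<and> E g = scale (\<psi> l) g"
  obtains C l where "finite C" "independent C" "span C = span B"
    "\<And>b. b \<in> C \<Longrightarrow> E b = scale (\<psi> (l b)) b"
    "trace B (X \<circ> E) = (\<Sum>b\<in>C. l b * \<psi> (l b))"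
proof -
  interpret X: Vector_Spaces.linear scale scale X by fact
  interpret E: Vector_Spaces.linear scale scale E by fact
  \<comment> \<open>No order on \<open>C\<close> is recorded: a trace sees only the diagonal entries
    \<open>representation C (X b) b\<close>, and these survive the insertion of a new vector because
    the old span is invariant.\<close>
  define good where "good = (\<lambda>(C, l). independent C \<and> C \<subseteq> span B \<and> X ` C \<subseteq> span C \<and>
    (\<forall>b\<in>C. E b = scale (\<psi> (l b)) b \<and> representation C (X b) b = l b))"
  have bound: "finite C \<and> card C \<le> card B" if "good (C, l)" for C l
    using that B independent_span_bound unfolding good_def by auto
  have "good ({}, \<lambda>_. 0)" by (simp add: good_def independent_empty)
  moreover have "\<forall>p. good p \<longrightarrow> card (fst p) < Suc (card B)"
    using bound by (auto simp: less_Suc_eq_le)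
  ultimately have "\<exists>p. good p \<and> (\<forall>q. good q \<longrightarrow> card (fst q) \<le> card (fst p))"
    by (rule Lattices_Big.ex_has_greatest_nat)
  then obtain p where "good p" "\<forall>q. good q \<longrightarrow> card (fst q) \<le> card (fst p)" by blast
  then obtain C l where C: "good (C, l)" and max: "\<And>D m. good (D, m) \<Longrightarrow> card D \<le> card C"
    by (cases p) fastforce
  have iC: "independent C" and CB: "C \<subseteq> span B" and XC: "X ` C \<subseteq> span C"
    and EC: "\<And>b. b \<in> C \<Longrightarrow> E b = scale (\<psi> (l b)) b"
    and rC: "\<And>b. b \<in> C \<Longrightarrow> representation C (X b) b = l b"
    using C unfolding good_def by auto
  have fC: "finite C" using bound[OF C] by simp
  have "G \<subseteq> span C"
  proof (rule ccontr)
    assume "\<not> G \<subseteq> span C"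
    then obtain g where g: "g \<in> G" "g \<notin> span C" by auto
    obtain m where m: "g \<in> gen_eig X m" "E g = scale (\<psi> m) g" using eig[OF g(1)] by auto
    define Y where "Y = (\<lambda>v. X v - scale m v)"
    obtain n where n: "(Y ^^ n) g = 0" using m(1) by (auto simp: gen_eig_def Y_def)
    have gB: "g \<in> span B" using g G by auto
    have "Y ` span B \<subseteq> span B"
      using X(2) by (auto simp: Y_def intro!: span_diff span_scale)
    then have YB: "(Y ^^ i) g \<in> span B" for i using gB by (rule funpow_closed)
    \<comment> \<open>Since \<open>X\<close> and \<open>E\<close> commute, whichever vector of the
      chain is added later is again an eigenvector of \<open>E\<close>.\<close>
    have YE: "E ((Y ^^ i) g) = scale (\<psi> m) ((Y ^^ i) g)" for i
    proof (induction i)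
      case 0
      show ?case using m by simp
    next
      case (Suc i)
      define w where "w = (Y ^^ i) g"
      have w: "w \<in> span B" "E w = scale (\<psi> m) w" using YB Suc by (simp_all add: w_def)
      have "E (Y w) = X (E w) - scale m (E w)"
        using w(1) by (simp add: Y_def E.diff E.scale comm)
      also have "\<dots> = scale (\<psi> m) (Y w)"
        by (simp add: w(2) Y_def X.scale algebra_simps)
      finally show ?case by (simp add: w_def)
    qed
    define k where "k = (LEAST k. (Y ^^ k) g \<in> span C)"
    have k: "(Y ^^ k) g \<in> span C"
      unfolding k_def by (rule LeastI[of _ n]) (simp add: n span_zero)
    have "k \<noteq> 0" using k g by (cases k) auto
    then obtain i where i: "k = Suc i" by (cases k) auto
    define u where "u = (Y ^^ i) g"
    have u: "u \<notin> span C"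
      using not_less_Least[of i "\<lambda>k. (Y ^^ k) g \<in> span C"] i unfolding k_def[symmetric] u_def by simp
    have Yu: "X u - scale m u \<in> span C" using k by (simp add: i u_def Y_def)
    have uC: "u \<notin> C" using u span_base by blast
    have iD: "independent (insert u C)" using u iC by (rule independent_insertI)
    have rep: "representation (insert u C) v = representation C v" if "v \<in> span C" for v
      using that by (intro representation_extend[OF iD]) auto
    have Xu: "X u = scale m u + (X u - scale m u)" by simp
    have "representation (insert u C) (X u) u =
        representation (insert u C) (scale m u) u + representation (insert u C) (X u - scale m u) u"
      by (subst Xu, subst representation_add[OF iD])
        (auto intro: span_scale span_base Yu[THEN subsetD[OF span_mono, rotated]])
    also have "representation (insert u C) (X u - scale m u) u = 0"
      unfolding rep[OF Yu] using uC representation_ne_zero by blast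
    also have "representation (insert u C) (scale m u) u = m"
      by (subst representation_scale[OF iD]) (auto simp: representation_basis[OF iD] span_base)
    finally have ru: "representation (insert u C) (X u) u = m" by simp
    have "good (insert u C, l(u := m))"
      unfolding good_def prod.case
    proof (intro conjI ballI)
      show "independent (insert u C)" by fact
      show "insert u C \<subseteq> span B" using YB CB u_def by simp
      have "X u \<in> span (insert u C)"
        by (subst Xu) (intro span_add span_scale span_base insertI1
          Yu[THEN subsetD[OF span_mono, rotated]] subset_insertI)
      then show "X ` insert u C \<subseteq> span (insert u C)"
        using XC span_mono[of C "insert u C"] by auto
      fix b assume b: "b \<in> insert u C"
      show "E b = scale (\<psi> ((l(u := m)) b)) b"
        using b uC EC YE[of i] by (auto simp: u_def)
      show "representation (insert u C) (X b) b = (l(u := m)) b"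
        using b uC rC rep XC ru by auto
    qed
    from max[OF this] show False using fC uC by simp
  qed
  then have sp: "span C = span B"
    using G CB by (metis span_eq span_minimal subspace_span subset_trans)
  have "trace B (X \<circ> E) = trace C (X \<circ> E)"
  proof (rule trace_basis)
    show "Vector_Spaces.linear scale scale (X \<circ> E)"
      by (rule linearI) (auto simp: X.add X.scale E.add E.scale)
    have "E g \<in> span C" if "g \<in> span C" for g
      using that
    proof (induction rule: span_induct_alt)
      case base show ?case by (simp add: span_zero)
    next
      case (step c x y)
      then show ?case by (simp add: E.add E.scale EC span_add span_scale span_base)
    qed
    then show "(X \<circ> E) ` span B \<subseteq> span B" using X(2) sp by auto
  qed (use B fC iC sp in auto)
  also have "\<dots> = (\<Sum>b\<in>C. l b * \<psi> (l b))"
    unfolding trace_def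
  proof (intro sum.cong refl)
    fix b assume b: "b \<in> C"
    have "representation C (X (E b)) b = \<psi> (l b) * representation C (X b) b"
      using b XC by (simp add: EC X.scale representation_scale[OF iC] image_subset_iff)
    then show "representation C ((X \<circ> E) b) b = l b * \<psi> (l b)" using rC[OF b] by simp
  qed
  finally show thesis using that fC iC sp EC by blast
qed

section \<open>Generalized eigenspaces and their independence\<close>

lemma gen_eigI: "((\<lambda>v. X v - scale l v) ^^ n) v = 0 \<Longrightarrow> v \<in> gen_eig X l"
  by (auto simp: gen_eig_def)

lemma funpow_zero_mono:
  assumes "Vector_Spaces.linear scale scale f" "(f ^^ n) v = 0" "n \<le> m"
  shows "(f ^^ m) v = 0"
proof -
  interpret fk: Vector_Spaces.linear scale scale "f ^^ (m - n)" by (rule linear_funpow) fact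
  have "(f ^^ m) v = (f ^^ (m - n)) ((f ^^ n) v)"
    using assms(3) by (metis comp_apply funpow_add le_add_diff_inverse2)
  then show ?thesis using assms by simp
qed

lemma subspace_gen_eig:
  assumes "Vector_Spaces.linear scale scale X"
  shows "subspace (gen_eig X l)"
proof (rule subspaceI)
  let ?Y = "\<lambda>v. X v - scale l v"
  have Y: "Vector_Spaces.linear scale scale ?Y" by (rule linear_shift) fact
  show "0 \<in> gen_eig X l" by (rule gen_eigI[where n=0]) simp
  {
    fix x y assume "x \<in> gen_eig X l" "y \<in> gen_eig X l"
    then obtain n m where nm: "(?Y ^^ n) x = 0" "(?Y ^^ m) y = 0" by (auto simp: gen_eig_def)
    interpret Yn: Vector_Spaces.linear scale scale "?Y ^^ (n + m)" by (rule linear_funpow[OF Y])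
    show "x + y \<in> gen_eig X l"
      using funpow_zero_mono[OF Y nm(1), of "n + m"] funpow_zero_mono[OF Y nm(2), of "n + m"]
      by (intro gen_eigI[where n="n + m"]) (simp add: Yn.add)
  }
  fix c x assume "x \<in> gen_eig X l"
  then obtain n where n: "(?Y ^^ n) x = 0" by (auto simp: gen_eig_def)
  interpret Yn: Vector_Spaces.linear scale scale "?Y ^^ n" by (rule linear_funpow[OF Y])
  show "scale c x \<in> gen_eig X l"
    using n by (intro gen_eigI[where n=n]) (simp add: Yn.scale)
qed

lemma gen_eig_shift:
  assumes "Vector_Spaces.linear scale scale X" "v \<in> gen_eig X l"
  shows "X v - scale m v \<in> gen_eig X l"
proof -
  interpret X: Vector_Spaces.linear scale scale X by fact
  let ?Y = "\<lambda>v. X v - scale l v"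
  obtain n where n: "(?Y ^^ n) v = 0" using assms by (auto simp: gen_eig_def)
  interpret Yn: Vector_Spaces.linear scale scale "?Y ^^ n"
    by (rule linear_funpow[OF linear_shift]) fact
  have "(?Y ^^ n) (?Y v) = 0"
    using funpow_zero_mono[OF linear_shift[OF assms(1)] n, of "Suc n"]
    by (simp add: funpow_Suc_right del: funpow.simps)
  then have "?Y v \<in> gen_eig X l" by (rule gen_eigI)
  then have "?Y v + scale (l - m) v \<in> gen_eig X l"
    using subspace_gen_eig[OF assms(1)] assms(2) by (intro subspace_add subspace_scale)
  then show ?thesis by (simp add: algebra_simps)
qed

lemma gen_eig_shift_D:
  assumes "X v - scale l v \<in> gen_eig X l"
  shows "v \<in> gen_eig X l"
proof -
  obtain n where "((\<lambda>v. X v - scale l v) ^^ n) (X v - scale l v) = 0"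
    using assms by (auto simp: gen_eig_def)
  then show ?thesis
    by (intro gen_eigI[where n="Suc n"]) (simp add: funpow_Suc_right del: funpow.simps)
qed

text \<open>Induction, applied to \<open>X v - m v\<close>, leaves a true eigenvector
  \<open>X v = m v\<close>; on it \<open>(X - l)^n\<close> is the scalar \<open>(m - l)^n\<close>,
  which is nonzero.\<close>

lemma gen_eig_inj:
  assumes "Vector_Spaces.linear scale scale X" "v \<in> gen_eig X l" "((\<lambda>v. X v - scale m v) ^^ k) v = 0" "l \<noteq> m"
  shows "v = 0"
  using assms(2,3)
proof (induction k arbitrary: v)
  case 0
  then show ?case by simp
next
  case (Suc k)
  interpret X: Vector_Spaces.linear scale scale X by fact
  let ?Y = "\<lambda>v. X v - scale m v"
  have "?Y v \<in> gen_eig X l" using Suc.prems assms(1) by (intro gen_eig_shift)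
  moreover have "(?Y ^^ k) (?Y v) = 0" 
    using Suc.prems by (simp add: funpow_Suc_right del: funpow.simps)
  ultimately have Xv: "X v = scale m v" using Suc.IH by fastforce
  obtain n where n: "((\<lambda>v. X v - scale l v) ^^ n) v = 0"
    using Suc.prems by (auto simp: gen_eig_def)
  have "((\<lambda>v. X v - scale l v) ^^ n) v = scale ((m - l) ^ n) v"
    by (induction n) (simp_all add: X.scale Xv algebra_simps)
  with n assms(4) show "v = 0" by simp
qed

text \<open>A power of \<open>X - m\<close> kills the summand for \<open>m\<close> and maps the
  other generalized eigenspaces injectively into themselves, so the induction hypothesis applies to
  the images of the remaining summands.\<close>

lemma gen_eig_independent:
  assumes "Vector_Spaces.linear scale scale X" "finite F" "\<And>l. l \<in> F \<Longrightarrow> v l \<in> gen_eig X l"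
    "(\<Sum>l\<in>F. v l) = 0" "l \<in> F"
  shows "v l = 0"
  using assms(2-5)
proof (induction F arbitrary: v l rule: finite_induct)
  case empty
  then show ?case by simp
next
  case (insert m F)
  let ?Y = "\<lambda>v. X v - scale m v"
  obtain n where n: "(?Y ^^ n) (v m) = 0" using insert.prems by (auto simp: gen_eig_def)
  interpret Yn: Vector_Spaces.linear scale scale "?Y ^^ n"
    by (rule linear_funpow[OF linear_shift]) fact
  have zero: "v l = 0" if "l \<in> F" for l
  proof -
    have "(?Y ^^ n) (\<Sum>l\<in>insert m F. v l) = 0" using insert.prems by simp
    then have "(\<Sum>l\<in>F. (?Y ^^ n) (v l)) = 0" using insert.hyps n by (simp add: Yn.add Yn.sum)
    moreover have "(?Y ^^ n) (v l) \<in> gen_eig X l" if "l \<in> F" for l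
      using insert.prems(1)[of l] that assms(1)
      by (intro funpow_closed) (auto intro: gen_eig_shift)
    ultimately have "(?Y ^^ n) (v l) = 0" using insert.IH[of "\<lambda>l. (?Y ^^ n) (v l)"] that by blast
    then show ?thesis
      using gen_eig_inj[OF assms(1)] insert.prems(1)[of l] insert.hyps that by blast
  qed
  then have "v m = 0" using insert.prems insert.hyps by simp
  then show ?case using zero insert.prems by auto
qed

section \<open>Polynomials in an operator and the primary decomposition\<close>

lemma poly_act_0 [simp]: "poly_act X 0 v = 0"
  by (simp add: poly_act_def)

lemma poly_act_pCons:
  assumes "Vector_Spaces.linear scale scale X"
  shows "poly_act X (pCons a p) v = scale a v + X (poly_act X p v)"
proof -
  interpret X: Vector_Spaces.linear scale scale X by fact
  show ?thesis
    by (cases "a = 0 \<and> p = 0") (auto simp: poly_act_def fold_coeffs_pCons_not_0_0_eq)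
qed

lemma poly_act_add:
  assumes "Vector_Spaces.linear scale scale X"
  shows "poly_act X (p + q) v = poly_act X p v + poly_act X q v"
proof -
  interpret X: Vector_Spaces.linear scale scale X by fact
  show ?thesis
    by (induction p q rule: poly_induct2)
      (auto simp: poly_act_pCons[OF assms] X.add scale_left_distrib)
qed

lemma poly_act_smult:
  assumes "Vector_Spaces.linear scale scale X"
  shows "poly_act X (smult c p) v = scale c (poly_act X p v)"
proof -
  interpret X: Vector_Spaces.linear scale scale X by fact
  show ?thesis
    by (induction p) (auto simp: poly_act_pCons[OF assms] X.scale scale_right_distrib)
qed

lemma poly_act_shift:
  assumes "Vector_Spaces.linear scale scale X"
  shows "poly_act X ([:- l, 1:] * p) v = poly_act X p (X v - scale l v)"
proof -
  interpret X: Vector_Spaces.linear scale scale X by fact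
  have "X (poly_act X p v) - scale l (poly_act X p v) = poly_act X p (X v - scale l v)"
    by (induction p)
      (auto simp: poly_act_pCons[OF assms] X.scale X.add X.diff algebra_simps simp flip: X.diff)
  moreover have "[:- l, 1:] * p = smult (- l) p + pCons 0 p" by simp
  ultimately show ?thesis
    by (simp only: poly_act_add[OF assms] poly_act_smult[OF assms] poly_act_pCons[OF assms]) simp
qed

lemma poly_act_monom:
  assumes "Vector_Spaces.linear scale scale X"
  shows "poly_act X (monom 1 n) v = (X ^^ n) v"
proof -
  interpret X: Vector_Spaces.linear scale scale X by fact
  show ?thesis
    by (induction n) (auto simp: monom_Suc monom_0 poly_act_pCons[OF assms])
qed

text \<open>The vectors \<open>v, X v, X^2 v, ...\<close> cannot stay independent inside a finite
  dimensional span.\<close>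

lemma annihilating_poly:
  assumes X: "Vector_Spaces.linear scale scale X" "X ` span B \<subseteq> span B"
    and B: "finite B" and v: "v \<in> span B"
  obtains p where "p \<noteq> 0" "poly_act X p v = 0"
proof -
  define A where "A = (\<lambda>n. (\<lambda>i. (X ^^ i) v) ` {..<n::nat})"
  have A_Suc: "A (Suc n) = insert ((X ^^ n) v) (A n)" for n
    by (auto simp: A_def lessThan_Suc)
  have AB: "A n \<subseteq> span B" for n
    using funpow_closed[OF X(2) v] by (auto simp: A_def)
  have "\<exists>n. (X ^^ n) v \<in> span (A n)"
  proof (rule ccontr)
    assume "\<not> ?thesis"
    then have new: "(X ^^ n) v \<notin> span (A n)" for n by blast
    have "independent (A n) \<and> card (A n) = n" for n
    proof (induction n)
      case 0
      show ?case by (simp add: A_def independent_empty)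
    next
      case (Suc n)
      have "(X ^^ n) v \<notin> A n" using new[of n] span_base by blast
      moreover have "finite (A n)" by (simp add: A_def)
      ultimately show ?case
        unfolding A_Suc using Suc new[of n] by (simp add: independent_insertI)
    qed
    then show False
      using independent_span_bound[OF B _ AB, of "Suc (card B)"] by simp
  qed
  then obtain n where n: "(X ^^ n) v \<in> span (A n)" by blast
  \<comment> \<open>\<open>q\<close> avoids the monomial of degree \<open>n\<close>, so that its
    difference from \<open>monom 1 n\<close> has coefficient 1 there and cannot be zero.\<close>
  have "\<exists>q. coeff q n = 0 \<and> poly_act X q v = w" if "w \<in> span (A n)" for w
    using that
  proof (induction rule: span_induct_alt)
    case base
    show ?case by (intro exI[of _ 0]) simp
  next
    case (step c x y)
    then obtain i q where i: "i < n" "x = (X ^^ i) v" and q: "coeff q n = 0" "poly_act X q v = y"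
      by (auto simp: A_def)
    show ?case
      using i q
      by (intro exI[of _ "smult c (monom 1 i) + q"])
        (simp add: poly_act_add[OF X(1)] poly_act_smult[OF X(1)] poly_act_monom[OF X(1)])
  qed
  then obtain q where q: "coeff q n = 0" "poly_act X q v = (X ^^ n) v" using n by blast
  have "coeff (monom 1 n + smult (- 1) q) n = 1" using q by simp
  then have "monom 1 n + smult (- 1) q \<noteq> 0" by (metis coeff_0 zero_neq_one)
  moreover have "poly_act X (monom 1 n + smult (- 1) q) v = 0"
    using q by (simp only: poly_act_add[OF X(1)] poly_act_smult[OF X(1)] poly_act_monom[OF X(1)]) simp
  ultimately show thesis by (rule that)
qed

text \<open>On the generalized eigenspace for \<open>m\<close>, \<open>X - l\<close> is the locally
  nilpotent \<open>X - m\<close> plus the nonzero scalar \<open>m - l\<close>, hence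
  invertible.\<close>

lemma gen_eig_shift_surj:
  assumes X: "Vector_Spaces.linear scale scale X" and W: "subspace W" "X ` W \<subseteq> W"
    and u: "u \<in> W" "((\<lambda>v. X v - scale m v) ^^ n) u = 0" and "l \<noteq> m"
  shows "\<exists>w \<in> gen_eig X m \<inter> W. X w - scale l w = u"
  using u
proof (induction n arbitrary: u)
  case 0
  interpret X: Vector_Spaces.linear scale scale X by fact
  show ?case
    using 0 subspace_0[OF subspace_gen_eig[OF X]] subspace_0[OF W(1)] by (intro bexI[of _ 0]) auto
next
  case (Suc n)
  interpret X: Vector_Spaces.linear scale scale X by fact
  let ?Y = "\<lambda>v. X v - scale m v"
  have "?Y u \<in> W" using Suc.prems W by (intro subspace_diff subspace_scale) auto
  moreover have "(?Y ^^ n) (?Y u) = 0"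
    using Suc.prems by (simp add: funpow_Suc_right del: funpow.simps)
  ultimately obtain w where w: "w \<in> gen_eig X m \<inter> W" "X w - scale l w = ?Y u"
    using Suc.IH by blast
  have "u \<in> gen_eig X m" using Suc.prems by (intro gen_eigI)
  \<comment> \<open>From \<open>(X - l) w = (X - m) u\<close> it follows that
    \<open>(X - l) (u - w) = (m - l) u\<close>.\<close>
  then have "scale (inverse (m - l)) (u - w) \<in> gen_eig X m \<inter> W"
    using w Suc.prems W subspace_gen_eig[OF X]
    by (auto intro!: subspace_scale subspace_diff)
  moreover have "X (scale k (u - w)) - scale l (scale k (u - w)) =
      scale k ((X u - scale m u) - (X w - scale l w) + scale (m - l) u)" for k
    by (simp add: X.scale X.diff algebra_simps)
  then have "X (scale (inverse (m - l)) (u - w)) - scale l (scale (inverse (m - l)) (u - w)) = u"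
    using w(2) \<open>l \<noteq> m\<close> by simp
  ultimately show ?case by blast
qed

end

text \<open>Each vector is annihilated by some polynomial, whose roots are split off one at a time:
  a vector that \<open>X - l\<close> carries into the span \<open>?G\<close> of the generalized
  eigenvectors already lies in \<open>?G\<close>.\<close>

lemma gen_eig_span:
  fixes scale :: "'a::alg_closed_field \<Rightarrow> 'b::ab_group_add \<Rightarrow> 'b" (infixr \<open>*s\<close> 75)
  assumes "vector_space scale"
  assumes X: "Vector_Spaces.linear scale scale X" "X ` module.span scale B \<subseteq> module.span scale B"
    and B: "finite B"
  shows "module.span scale B =
    module.span scale (\<Union>l. vector_space.gen_eig scale X l \<inter> module.span scale B)"
proof -
  interpret vector_space scale by fact
  interpret X: Vector_Spaces.linear scale scale X by fact
  let ?W = "span B"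
  let ?G = "span (\<Union>l. gen_eig X l \<inter> ?W)"
  have GW: "?G \<subseteq> ?W" by (intro span_minimal) auto
  have eig_G: "gen_eig X l \<inter> ?W \<subseteq> ?G" for l
    by (rule order_trans[OF _ span_superset]) blast
  \<comment> \<open>On generalized eigenspaces for values other than \<open>l\<close>, the operator
    \<open>X - l\<close> is onto; only the component for \<open>l\<close> is left over as
    \<open>z\<close>.\<close>
  have split: "\<exists>g\<in>?G. \<exists>z\<in>gen_eig X l \<inter> ?W. w = (X g - l *s g) + z" if "w \<in> ?G" for w l
    using that
  proof (induction rule: span_induct_alt)
    case base
    show ?case
      using subspace_0[OF subspace_gen_eig[OF X(1)]]
      by (intro bexI[of _ 0]) (auto simp: span_zero)
  next
    case (step c x y)
    obtain g z where y: "g \<in> ?G" "z \<in> gen_eig X l \<inter> ?W" "y = (X g - l *s g) + z"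
      using step by blast
    obtain m where m: "x \<in> gen_eig X m" "x \<in> ?W" using step by blast
    then obtain n where n: "((\<lambda>v. X v - m *s v) ^^ n) x = 0" by (auto simp: gen_eig_def)
    show ?case
    proof (cases "l = m")
      case True
      have "c *s x + z \<in> gen_eig X l \<inter> ?W"
        using y m True subspace_gen_eig[OF X(1)]
        by (auto intro!: subspace_add subspace_scale span_add span_scale)
      then show ?thesis
        using y by (intro bexI[of _ g] bexI[of _ "c *s x + z"]) (auto simp: algebra_simps)
    next
      case False
      obtain w where w: "w \<in> gen_eig X m \<inter> ?W" "X w - l *s w = x"
        using gen_eig_shift_surj[OF X(1) subspace_span X(2) m(2) n False] by blast
      have "w \<in> ?G" using w(1) eig_G by blast
      then have "c *s w + g \<in> ?G" using y by (intro span_add span_scale)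
      moreover have "c *s x + y = (X (c *s w + g) - l *s (c *s w + g)) + z"
        unfolding w(2)[symmetric] y(3) by (simp add: X.add X.scale algebra_simps)
      ultimately show ?thesis using y(2) by blast
    qed
  qed
  \<comment> \<open>\<open>X - l\<close> carries \<open>v - g\<close> to a generalized eigenvector
    for \<open>l\<close>, so \<open>v - g\<close> is one itself.\<close>
  have step: "v \<in> ?G" if v: "v \<in> ?W" "X v - l *s v \<in> ?G" for v l
  proof -
    obtain g z where g: "g \<in> ?G" "z \<in> gen_eig X l \<inter> ?W" "X v - l *s v = (X g - l *s g) + z"
      using split[OF v(2)] by blast
    have "X (v - g) - l *s (v - g) = z" using g(3) by (simp add: X.diff algebra_simps)
    then have "v - g \<in> gen_eig X l" using g(2) by (auto intro: gen_eig_shift_D)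
    moreover have "v - g \<in> ?W" using v(1) g(1) GW by (auto intro: span_diff)
    ultimately have "v - g \<in> ?G" using eig_G by blast
    then have "v - g + g \<in> ?G" using g(1) by (rule span_add)
    then show ?thesis by simp
  qed
  have main: "v \<in> ?G" if "p \<noteq> 0" "poly_act X p v = 0" "v \<in> ?W" for p v
    using that
  proof (induction "degree p" arbitrary: p v)
    case 0
    then obtain c where "p = [:c:]" by (metis degree_eq_zeroE)
    then have "v = 0" using 0 by (simp add: poly_act_pCons[OF X(1)])
    then show ?case by (simp add: span_zero)
  next
    case (Suc n)
    obtain l where "poly p l = 0" using alg_closed_imp_poly_has_root[of p] Suc by auto
    then obtain q where q: "p = [:- l, 1:] * q" by (metis dvdE poly_eq_0_iff_dvd)
    have "q \<noteq> 0" using Suc.prems q by auto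
    then have "degree p = Suc (degree q)" unfolding q by (subst degree_mult_eq) auto
    moreover have "X v - l *s v \<in> ?W" using Suc.prems X(2) by (auto intro!: span_diff span_scale)
    moreover have "poly_act X q (X v - l *s v) = 0"
      using Suc.prems(2) by (simp only: q poly_act_shift[OF X(1)])
    ultimately have "X v - l *s v \<in> ?G"
      using Suc.hyps(2) by (intro Suc.hyps(1)[OF _ \<open>q \<noteq> 0\<close>]) auto
    then show ?case by (rule step[OF Suc.prems(3)])
  qed
  have "?W \<subseteq> ?G"
  proof
    fix v assume v: "v \<in> ?W"
    obtain p where "p \<noteq> 0" "poly_act X p v = 0" using annihilating_poly[OF X B v] .
    then show "v \<in> ?G" using v by (rule main)
  qed
  with GW show ?thesis by blast
qed

text \<open>\<open>E\<close> is prescribed on a basis of generalized eigenvectors. That it is a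
  scalar on all of an eigenspace, and not only on the basis vectors inside it, rests on
  independence: a vector for \<open>m\<close> has components for \<open>m\<close> only.\<close>

lemma (in vector_space) eigenspace_operator:
  assumes X: "Vector_Spaces.linear scale scale X"
    and W: "subspace W" "W = span (\<Union>l. gen_eig X l \<inter> W)"
  obtains E where "Vector_Spaces.linear scale scale E" "E ` W \<subseteq> W"
    "\<And>l v. v \<in> gen_eig X l \<Longrightarrow> v \<in> W \<Longrightarrow> E v = scale (\<psi> l) v"
proof -
  interpret vector_space_pair scale scale ..
  let ?U = "\<Union>l. gen_eig X l \<inter> W"
  obtain C where C: "C \<subseteq> ?U" "independent C" "?U \<subseteq> span C"
    using maximal_independent_subset[of ?U] by blast
  have CW: "span C = W" using C W by (metis span_eq span_minimal span_mono subset_antisym subspace_span)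
  have "\<forall>b\<in>C. \<exists>l. b \<in> gen_eig X l" using C by auto
  then obtain l where l: "\<And>b. b \<in> C \<Longrightarrow> b \<in> gen_eig X (l b)" by metis
  define E where "E = construct C (\<lambda>b. scale (\<psi> (l b)) b)"
  have E: "Vector_Spaces.linear scale scale E"
    unfolding E_def by (rule linear_construct) fact
  interpret E: Vector_Spaces.linear scale scale E by fact
  have EC: "E b = scale (\<psi> (l b)) b" if "b \<in> C" for b
    unfolding E_def by (rule construct_basis) (use C that in auto)
  have EW: "E v \<in> W" if "v \<in> span C" for v
    using that
  proof (induction rule: span_induct_alt)
    case base show ?case using W by (simp add: subspace_0)
  next
    case (step c x y)
    then have "x \<in> W" using CW span_base by blast
    then show ?case using step W by (auto simp: E.add E.scale EC intro!: subspace_add subspace_scale)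
  qed
  have "E v = scale (\<psi> m) v" if v: "v \<in> gen_eig X m" "v \<in> W" for m v
  proof -
    define r where "r = representation C v"
    define S where "S = {b. r b \<noteq> 0}"
    \<comment> \<open>\<open>m\<close> is inserted so that the family which is \<open>v\<close> at
      \<open>m\<close> and 0 elsewhere sums to \<open>v\<close> even if no vector of
      \<open>S\<close> belongs to \<open>m\<close>.\<close>
    define F where "F = insert m (l ` S)"
    have S: "finite S" "S \<subseteq> C"
      using finite_representation[of C v] representation_ne_zero[of C v] by (auto simp: S_def r_def)
    have vS: "v = (\<Sum>b\<in>S. scale (r b) b)"
      unfolding S_def r_def using C(2) v(2) CW by (simp add: sum_nonzero_representation_eq)
    define part where "part = (\<lambda>k. \<Sum>b\<in>{b\<in>S. l b = k}. scale (r b) b)"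
    have F: "finite F" "l ` S \<subseteq> F" using S by (auto simp: F_def)
    have part_eig: "part k \<in> gen_eig X k" for k
      unfolding part_def using S l
      by (intro subspace_sum subspace_scale subspace_gen_eig[OF X]) auto
    have "(\<Sum>k\<in>F. part k) = v"
      unfolding part_def using vS sum.group[OF S(1) F, of "\<lambda>b. scale (r b) b"] by simp
    moreover have "(\<Sum>k\<in>F. if k = m then v else 0) = v"
      using F by (simp add: F_def)
    ultimately have "(\<Sum>k\<in>F. part k - (if k = m then v else 0)) = 0"
      by (simp add: sum_subtractf)
    then have "part k - (if k = m then v else 0) = 0" if "k \<in> F" for k
      by (intro gen_eig_independent[OF X F(1), of "\<lambda>k. part k - (if k = m then v else 0)"] that
          subspace_diff subspace_gen_eig[OF X] part_eig)
        (use v(1) subspace_0[OF subspace_gen_eig[OF X]] in auto)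
    then have part: "part k = (if k = m then v else 0)" if "k \<in> F" for k using that by auto
    have "E v = (\<Sum>b\<in>S. scale (\<psi> (l b)) (scale (r b) b))"
      by (subst vS) (use S in \<open>auto simp: E.sum E.scale EC mult.commute intro!: sum.cong\<close>)
    also have "\<dots> = (\<Sum>k\<in>F. \<Sum>b\<in>{b\<in>S. l b = k}. scale (\<psi> (l b)) (scale (r b) b))"
      by (rule sum.group[symmetric]) (use S F in auto)
    also have "\<dots> = (\<Sum>k\<in>F. scale (\<psi> k) (part k))"
      unfolding part_def scale_sum_right by (intro sum.cong) auto
    also have "\<dots> = (\<Sum>k\<in>F. if k = m then scale (\<psi> m) v else 0)"
      by (intro sum.cong refl) (simp add: part)
    also have "\<dots> = scale (\<psi> m) v" using F by (simp add: F_def)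
    finally show ?thesis .
  qed
  then show thesis using that E EW CW by (metis image_subsetI)
qed

subsection \<open>Engel's theorem\<close>

lemma (in vector_space) vector_space_fun: "vector_space (\<lambda>c (f :: 'c \<Rightarrow> 'b) x. scale c (f x))"
  by unfold_locales (auto simp: fun_eq_iff algebra_simps)

definition commutator :: "('a \<Rightarrow> 'a) \<Rightarrow> ('a \<Rightarrow> 'a) \<Rightarrow> 'a \<Rightarrow> 'a::ab_group_add" where
  "commutator X Y = (\<lambda>v. X (Y v) - Y (X v))"

text \<open>The chain V, hV, hhV, ... of the ambient space V. For linear operators, reaching 0 means
  that all products of some fixed length of members of \<open>h\<close> vanish: the joint nilpotency
  of Engel's theorem.\<close>

primrec (in vector_space) lower_series :: "('b \<Rightarrow> 'b) set \<Rightarrow> nat \<Rightarrow> 'b set" where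
  "lower_series h 0 = UNIV"
| "lower_series h (Suc n) = span {X v | X v. X \<in> h \<and> v \<in> lower_series h n}"

context vector_space
begin

lemma subspace_lower_series: "subspace (lower_series h n)"
  by (cases n) auto

lemma lower_series_step: "X \<in> h \<Longrightarrow> v \<in> lower_series h n \<Longrightarrow> X v \<in> lower_series h (Suc n)"
  by (auto intro: span_base)

lemma lower_series_Suc_subset: "lower_series h (Suc n) \<subseteq> lower_series h n"
proof (induction n)
  case 0
  show ?case by simp
next
  case (Suc n)
  then have "{X v | X v. X \<in> h \<and> v \<in> lower_series h (Suc n)}
      \<subseteq> {X v | X v. X \<in> h \<and> v \<in> lower_series h n}" by blast
  then show ?case by (simp only: lower_series.simps(2)[of h "Suc n"] lower_series.simps(2)[of h n] span_mono)
qed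

lemma lower_series_antimono: "m \<le> n \<Longrightarrow> lower_series h n \<subseteq> lower_series h m"
  by (rule lift_Suc_antimono_le[of "lower_series h"]) (rule lower_series_Suc_subset)

interpretation fn: vector_space "\<lambda>c (f :: 'b \<Rightarrow> 'b) x. scale c (f x)"
  by (rule vector_space_fun)

text \<open>\<open>X\<close> normalizes \<open>k\<close> and therefore preserves each
  \<open>lower_series k i\<close>. On the quotient of consecutive terms the members of
  \<open>k'\<close> act as multiples of \<open>X\<close>, so \<open>M\<close> of them lead one term
  further down; this gives the length \<open>N * M\<close>.\<close>

lemma lower_series_extend:
  assumes k: "\<And>Y. Y \<in> k \<Longrightarrow> Vector_Spaces.linear scale scale Y" "lower_series k N = {0}"
    and X: "Vector_Spaces.linear scale scale X" "\<And>v. (X ^^ M) v = 0"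
    and XY: "\<And>Y. Y \<in> k \<Longrightarrow> commutator Y X \<in> k"
    and k': "\<And>Z. Z \<in> k' \<Longrightarrow> \<exists>Y\<in>k. \<exists>c. Z = (\<lambda>v. Y v + scale c (X v))"
  shows "lower_series k' (N * M) = {0}"
proof -
  interpret X: Vector_Spaces.linear scale scale X by fact
  let ?W = "lower_series k"
  have XW: "X ` ?W i \<subseteq> ?W i" for i
  proof (induction i)
    case 0
    show ?case by simp
  next
    case (Suc i)
    have "X v \<in> ?W (Suc i)" if "v \<in> ?W (Suc i)" for v
      using that unfolding lower_series.simps
    proof (induction rule: span_induct_alt)
      case base
      show ?case by (simp add: span_zero)
    next
      case (step c x y)
      then obtain Y w where x: "x = Y w" "Y \<in> k" "w \<in> ?W i" by auto
      have "X x = Y (X w) - commutator Y X w" by (simp add: x commutator_def)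
      moreover have "Y (X w) \<in> ?W (Suc i)"
        using Suc.IH x by (intro lower_series_step) auto
      moreover have "commutator Y X w \<in> ?W (Suc i)"
        using x XY by (intro lower_series_step) auto
      ultimately have "X x \<in> ?W (Suc i)" by (simp only: subspace_diff subspace_lower_series)
      then show ?case using step.IH by (simp add: X.add X.scale span_add span_scale)
    qed
    then show ?case by blast
  qed
  then have XnW: "(X ^^ j) v \<in> ?W i" if "v \<in> ?W i" for i j v
    using that by (rule funpow_closed)
  \<comment> \<open>\<open>U i j\<close> interpolates between two terms of the series of
    \<open>k\<close>: for \<open>j = 0\<close> it is the term \<open>i\<close>, for
    \<open>j = M\<close> it is the term \<open>Suc i\<close> because \<open>X ^^ M\<close> is 0. One
    operator of \<open>k'\<close> raises \<open>j\<close> by one.\<close>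
  define U where "U = (\<lambda>i j. {a + (X ^^ j) b | a b. a \<in> ?W (Suc i) \<and> b \<in> ?W i})"
  have UI: "a \<in> ?W (Suc i) \<Longrightarrow> b \<in> ?W i \<Longrightarrow> a + (X ^^ j) b \<in> U i j" for a b i j
    unfolding U_def by blast
  have sU: "subspace (U i j)" for i j
  proof (rule subspaceI)
    interpret Xj: Vector_Spaces.linear scale scale "X ^^ j" by (rule linear_funpow) fact
    show "0 \<in> U i j"
      using UI[OF subspace_0 subspace_0, OF subspace_lower_series subspace_lower_series, of j i]
      by (simp add: Xj.zero)
    fix x assume "x \<in> U i j"
    then obtain a b where x: "x = a + (X ^^ j) b" "a \<in> ?W (Suc i)" "b \<in> ?W i" by (auto simp: U_def)
    have "scale c x = scale c a + (X ^^ j) (scale c b)" for c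
      by (simp add: x Xj.scale scale_right_distrib)
    then show "scale c x \<in> U i j" for c
      using UI[OF subspace_scale subspace_scale, OF subspace_lower_series x(2) subspace_lower_series x(3)]
      by metis
    fix y assume "y \<in> U i j"
    then obtain a' b' where y: "y = a' + (X ^^ j) b'" "a' \<in> ?W (Suc i)" "b' \<in> ?W i"
      by (auto simp: U_def)
    have "x + y = (a + a') + (X ^^ j) (b + b')" by (simp add: x y Xj.add)
    then show "x + y \<in> U i j"
      using UI[OF subspace_add subspace_add, OF subspace_lower_series x(2) y(2) subspace_lower_series x(3) y(3)]
      by metis
  qed
  have U: "lower_series k' (i * M + j) \<subseteq> U i j" if "lower_series k' (i * M) \<subseteq> ?W i" for i j
  proof (induction j)
    case 0
    show ?case using that UI[OF subspace_0[OF subspace_lower_series], of _ i 0] by auto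
  next
    case (Suc j)
    have "{Z v | Z v. Z \<in> k' \<and> v \<in> lower_series k' (i * M + j)} \<subseteq> U i (Suc j)"
    proof clarify
      fix Z v assume Z: "Z \<in> k'" and "v \<in> lower_series k' (i * M + j)"
      then obtain a b where v: "v = a + (X ^^ j) b" "a \<in> ?W (Suc i)" "b \<in> ?W i"
        using Suc.IH by (auto simp: U_def)
      obtain Y c where Y: "Y \<in> k" "Z = (\<lambda>v. Y v + scale c (X v))" using k'[OF Z] by blast
      have "Z v = (Y v + scale c (X a)) + (X ^^ Suc j) (scale c b)"
      proof -
        interpret Xj: Vector_Spaces.linear scale scale "X ^^ j" by (rule linear_funpow) fact
        show ?thesis by (simp add: Y v X.add Xj.scale X.scale algebra_simps)
      qed
      moreover have "v \<in> ?W i"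
        using v XnW lower_series_Suc_subset[of k i] subspace_lower_series
        by (auto intro!: subspace_add simp del: lower_series.simps)
      then have "Y v \<in> ?W (Suc i)" using Y(1) by (intro lower_series_step)
      then have "Y v + scale c (X a) \<in> ?W (Suc i)"
        using XW v(2) by (intro subspace_add subspace_scale subspace_lower_series)
          (auto simp del: lower_series.simps)
      ultimately show "Z v \<in> U i (Suc j)"
        using v(3) UI[of "Y v + scale c (X a)" i "scale c b" "Suc j"]
        by (metis subspace_lower_series subspace_scale)
    qed
    then show ?case using sU by (simp add: span_minimal)
  qed
  have "lower_series k' (i * M) \<subseteq> ?W i" for i
  proof (induction i)
    case 0
    show ?case by simp
  next
    case (Suc i)
    have "U i M \<subseteq> ?W (Suc i)" by (auto simp: U_def X(2))
    with U[OF Suc.IH, of M] show ?case by (simp add: add.commute)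
  qed
  from this[of N] show ?thesis
    using k(2) subspace_0[OF subspace_lower_series[of k' "N * M"]] by auto
qed

text \<open>Among the subalgebras of \<open>h\<close> that act nilpotently, one of largest dimension
  is taken, the dimension being measured by an independent subset \<open>C\<close>. If it is not
  \<open>h\<close>, some \<open>X\<close> outside normalizes it, and adjoining \<open>X\<close>
  contradicts maximality.\<close>

theorem Engel:
  assumes h: "fn.subspace h" "finite F" "h \<subseteq> fn.span F"
    and lin: "\<And>X. X \<in> h \<Longrightarrow> Vector_Spaces.linear scale scale X"
    and nil: "\<And>X. X \<in> h \<Longrightarrow> \<exists>n. \<forall>v. (X ^^ n) v = 0"
    and comm: "\<And>X Y. X \<in> h \<Longrightarrow> Y \<in> h \<Longrightarrow> commutator X Y \<in> h"
  shows "\<exists>n. lower_series h n = {0}"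
proof -
  define good where "good = (\<lambda>(k, C). fn.subspace k \<and> k \<subseteq> h \<and>
    (\<forall>X\<in>k. \<forall>Y\<in>k. commutator X Y \<in> k) \<and> (\<exists>n. lower_series k n = {0}) \<and>
    fn.independent C \<and> C \<subseteq> k)"
  have bound: "finite C \<and> card C \<le> card F" if "good (k, C)" for k C
    using that h fn.independent_span_bound[of F C] unfolding good_def by auto
  have "good ({0}, {})"
  proof -
    have "lower_series {0} 1 = {0}" by (auto simp: span_zero intro: span_minimal[THEN subsetD])
    then have "\<exists>n. lower_series {0} n = {0}" by blast
    then show ?thesis
      using fn.subspace_0[OF h(1)]
      by (auto simp: good_def fn.independent_empty commutator_def fun_eq_iff)
  qed
  moreover have "\<forall>p. good p \<longrightarrow> card (snd p) < Suc (card F)"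
    using bound by (auto simp: less_Suc_eq_le)
  ultimately have "\<exists>p. good p \<and> (\<forall>q. good q \<longrightarrow> card (snd q) \<le> card (snd p))"
    by (rule Lattices_Big.ex_has_greatest_nat)
  then obtain p where p: "good p" "\<forall>q. good q \<longrightarrow> card (snd q) \<le> card (snd p)" by blast
  obtain k C where [simp]: "p = (k, C)" by (cases p)
  have max: "card D \<le> card C" if "good (k', D)" for k' D using p(2) that by force
  from p(1) obtain N where k: "fn.subspace k" "k \<subseteq> h"
    "\<And>X Y. X \<in> k \<Longrightarrow> Y \<in> k \<Longrightarrow> commutator X Y \<in> k" "lower_series k N = {0}"
    and C: "fn.independent C" "C \<subseteq> k"
    unfolding good_def by auto
  let ?W = "lower_series k"
  have linD: "Vector_Spaces.linear scale scale Y" if "Y \<in> k" for Y using lin k(2) that by blast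
  have Y0: "Y 0 = 0" if "Y \<in> h" for Y
  proof -
    interpret Y: Vector_Spaces.linear scale scale Y using lin that .
    show ?thesis by simp
  qed
  have "h \<subseteq> k"
  proof (rule ccontr)
    assume "\<not> h \<subseteq> k"
    then obtain Z0 where Z0: "Z0 \<in> h" "Z0 \<notin> k" by blast
    \<comment> \<open>Otherwise iterated commutators with elements of \<open>k\<close> lead from
      \<open>Z0\<close> to elements outside \<open>k\<close> forever. Expanded, a
      \<open>j\<close>-fold commutator is a combination of words with \<open>j\<close> letters from
      \<open>k\<close>, and such words vanish for large \<open>j\<close>.\<close>
    have "\<exists>X\<in>h - k. \<forall>Y\<in>k. commutator Y X \<in> k"
    proof (rule ccontr)
      assume neg: "\<not> ?thesis"
      \<comment> \<open>words \<open>Y\<^sub>1 \<cdots> Y\<^sub>a Z Y\<^sub>1' \<cdots> Y\<^sub>b'\<close> with letters from \<open>k\<close> around some \<open>Z \<in> h\<close>\<close>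
      define word where "word = (\<lambda>a b. {Z. (\<forall>v. Z v \<in> ?W a) \<and> (\<forall>v\<in>?W (N - b). Z v = 0)})"
      define H where "H = (\<lambda>j. fn.span (\<Union>a\<in>{..j}. word a (j - a)))"
      have H_eq: "H j = fn.span (\<Union>a\<in>{..j}. word a (j - a))" for j by (simp add: H_def)
      have wordH: "Z \<in> H (a + b)" if "Z \<in> word a b" for Z a b
        unfolding H_def by (rule fn.span_base) (use that in \<open>auto intro!: bexI[of _ a]\<close>)
      have word_left: "(\<lambda>v. Y (Z v)) \<in> word (Suc a) b" if "Y \<in> k" "Z \<in> word a b" for Y Z a b
        using that k(2) Y0 lower_series_step[OF that(1)]
        by (auto simp: word_def simp del: lower_series.simps)
      have word_right: "(\<lambda>v. Z (Y v)) \<in> word a (Suc b)" if "Y \<in> k" "Z \<in> word a b" for Y Z a b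
      \<comment> \<open>The subtraction in \<open>N - b\<close> is truncated: for
        \<open>b \<ge> N\<close> membership already says that \<open>Z\<close> vanishes on the whole
        space \<open>?W 0\<close>.\<close>
      proof (cases "b < N")
        case True
        then have "N - b = Suc (N - Suc b)" by simp
        then show ?thesis
          using that lower_series_step[OF that(1), of _ "N - Suc b"]
          by (auto simp: word_def simp del: lower_series.simps)
      next
        case False
        then show ?thesis using that by (auto simp: word_def)
      qed
      have H_step: "commutator Y Z \<in> H (Suc j)" if Y: "Y \<in> k" and "Z \<in> H j" for Y Z j
        using that(2) unfolding H_eq[of j]
      proof (induction rule: fn.span_induct_alt)
        case base
        have "commutator Y 0 = 0" using Y k(2) Y0 by (auto simp: commutator_def fun_eq_iff)
        moreover have "0 \<in> H (Suc j)" unfolding H_def by (rule fn.span_zero)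
        ultimately show ?case by (simp only: zero_fun_def)
      next
        case (step c x y)
        interpret Y: Vector_Spaces.linear scale scale Y using linD[OF Y] .
        from step(1) obtain a where a: "a \<in> {..j}" and x: "x \<in> word a (j - a)"
          by (rule UN_E)
        define b where "b = j - a"
        have ab: "a + b = j" and x: "x \<in> word a b" using a x by (auto simp: b_def)
        have "(\<lambda>v. Y (x v)) \<in> H (Suc j)" using wordH[OF word_left[OF Y x]] ab by simp
        moreover have "(\<lambda>v. x (Y v)) \<in> H (Suc j)" using wordH[OF word_right[OF Y x]] ab by simp
        ultimately have "(\<lambda>v. Y (x v)) - (\<lambda>v. x (Y v)) \<in> H (Suc j)"
          unfolding H_def by (rule fn.span_diff)
        then have "(\<lambda>v. scale c (((\<lambda>v. Y (x v)) - (\<lambda>v. x (Y v))) v)) + commutator Y y \<in> H (Suc j)"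
          using step.IH unfolding H_def by (intro fn.span_add fn.span_scale)
        also have "(\<lambda>v. scale c (((\<lambda>v. Y (x v)) - (\<lambda>v. x (Y v))) v)) + commutator Y y
            = commutator Y ((\<lambda>v. scale c (x v)) + y)"
          by (auto simp: commutator_def fun_eq_iff Y.add Y.scale algebra_simps)
        finally show ?case .
      qed
      have "\<exists>Z\<in>h - k. Z \<in> H j" for j
      proof (induction j)
        case 0
        have "Z0 \<in> word 0 0" using Y0[OF Z0(1)] k(4) by (auto simp: word_def)
        then show ?case using wordH[of Z0 0 0] Z0 by auto
      next
        case (Suc j)
        then obtain Z where Z: "Z \<in> h - k" "Z \<in> H j" by blast
        then obtain Y where Y: "Y \<in> k" "commutator Y Z \<notin> k" using neg by blast
        then have "commutator Y Z \<in> h - k" using Z k(2) comm by blast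
        then show ?case using H_step[OF Y(1) Z(2)] by blast
      qed
      then obtain Z where Z: "Z \<in> h - k" "Z \<in> H (2 * N)" by blast
      \<comment> \<open>Of \<open>2 * N\<close> letters at least \<open>N\<close> stand on one side.
        On the left they force the image into \<open>?W N\<close>, which is 0; on the right they
        make the word vanish on \<open>?W 0\<close>, which is everything.\<close>
      have "word a (2 * N - a) \<subseteq> {0}" if "a \<le> 2 * N" for a
      proof (cases "a \<ge> N")
        case True
        then show ?thesis
          using lower_series_antimono[of N a k] k(4)
          by (auto simp: word_def fun_eq_iff subset_iff simp del: lower_series.simps)
      next
        case False
        then have "N - (2 * N - a) = 0" by simp
        then show ?thesis by (auto simp: word_def fun_eq_iff)
      qed
      then have "H (2 * N) \<subseteq> {0}"
        unfolding H_def by (intro fn.span_minimal UN_least) auto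
      then show False using Z fn.subspace_0[OF k(1)] by auto
    qed
    then obtain X where X: "X \<in> h" "X \<notin> k" and XY: "\<And>Y. Y \<in> k \<Longrightarrow> commutator Y X \<in> k" by blast
    define k' where "k' = {(\<lambda>v. Y v + scale c (X v)) | Y c. Y \<in> k}"
    have k'_eq: "k' = fn.span (insert X k)"
    proof -
      have "fn.span k = k" using k(1) by simp
      show ?thesis
      proof (intro set_eqI iffI)
        fix Z assume "Z \<in> k'"
        then obtain Y c where Y: "Y \<in> k" "Z = (\<lambda>v. Y v + scale c (X v))" by (auto simp: k'_def)
        then have "Z = Y + (\<lambda>v. scale c (X v))" by (auto simp: fun_eq_iff)
        then show "Z \<in> fn.span (insert X k)"
          using Y(1) by (auto intro!: fn.span_add fn.span_scale intro: fn.span_base)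
      next
        fix Z assume "Z \<in> fn.span (insert X k)"
        then obtain c where "Z - (\<lambda>v. scale c (X v)) \<in> k"
          unfolding fn.span_insert \<open>fn.span k = k\<close> by blast
        then show "Z \<in> k'"
          unfolding k'_def
          by (intro CollectI exI[of _ "Z - (\<lambda>v. scale c (X v))"] exI[of _ c]) (auto simp: fun_eq_iff)
      qed
    qed
    obtain M where M: "\<And>v. (X ^^ M) v = 0" using nil[OF X(1)] by blast
    have "good (k', insert X C)"
      unfolding good_def prod.case
    proof (intro conjI ballI)
      show "fn.subspace k'" unfolding k'_eq by simp
      show "k' \<subseteq> h" unfolding k'_eq using X(1) k(2) h(1) by (intro fn.span_minimal) auto
      show "\<exists>n. lower_series k' n = {0}"
        using lower_series_extend[OF linD k(4) lin[OF X(1)] M XY, of k'] by (auto simp: k'_def)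
      have "fn.span C \<subseteq> k" using C(2) k(1) by (rule fn.span_minimal)
      then show "fn.independent (insert X C)"
        using X(2) C(1) by (intro fn.independent_insertI) auto
      show "insert X C \<subseteq> k'" unfolding k'_eq using C(2) fn.span_superset[of "insert X k"] by auto
      fix Z Z' assume "Z \<in> k'" "Z' \<in> k'"
      then obtain Y c Y' c' where Z: "Y \<in> k" "Z = (\<lambda>v. Y v + scale c (X v))"
        and Z': "Y' \<in> k" "Z' = (\<lambda>v. Y' v + scale c' (X v))"
        unfolding k'_def by blast
      interpret X: Vector_Spaces.linear scale scale X using lin[OF X(1)] .
      interpret Y: Vector_Spaces.linear scale scale Y using linD[OF Z(1)] .
      interpret Y': Vector_Spaces.linear scale scale Y' using linD[OF Z'(1)] .
      have "commutator Z Z' = (commutator Y Y' + (\<lambda>v. scale c' (commutator Y X v)))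
          - (\<lambda>v. scale c (commutator Y' X v))"
        by (auto simp: Z Z' commutator_def fun_eq_iff X.add Y.add Y'.add X.scale Y.scale Y'.scale
            algebra_simps)
      also have "\<dots> \<in> k"
        using k(3)[OF Z(1) Z'(1)] XY[OF Z(1)] XY[OF Z'(1)]
        by (intro fn.subspace_diff fn.subspace_add fn.subspace_scale k(1))
      also have "k \<subseteq> k'" unfolding k'_eq using fn.span_superset[of "insert X k"] by auto
      finally show "commutator Z Z' \<in> k'" .
    qed
    from max[OF this] have "card (insert X C) \<le> card C" .
    moreover have "X \<notin> C" "finite C" using X(2) C bound p(1) by auto
    ultimately show False by simp
  qed
  then show ?thesis using k(2,4) by (intro exI[of _ N]) (metis subset_antisym)
qed

end

subsection \<open>Perfect ideals orthogonal to the whole system\<close>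

text \<open>The field is a vector space over the rationals in which a nonzero \<open>l\<close> alone
  is independent; any linear extension of \<open>l \<mapsto> 1\<close> serves.\<close>

lemma rational_functional:
  fixes l :: "'k::field_char_0"
  assumes "l \<noteq> 0"
  obtains \<phi> :: "'k \<Rightarrow> rat" where "\<phi> l = 1" "\<And>x y. \<phi> (x + y) = \<phi> x + \<phi> y"
    "\<And>x q. \<phi> (x * of_rat q) = \<phi> x * q"
proof -
  interpret Q: vector_space "\<lambda>(q::rat) (x::'k). of_rat q * x"
    by unfold_locales (auto simp: algebra_simps of_rat_add of_rat_mult)
  interpret R: vector_space "(*) :: rat \<Rightarrow> rat \<Rightarrow> rat"
    by unfold_locales (auto simp: algebra_simps)
  interpret vector_space_pair "\<lambda>(q::rat) (x::'k). of_rat q * x" "(*) :: rat \<Rightarrow> rat \<Rightarrow> rat" ..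
  have "Q.independent {l}" using assms by (simp add: Q.dependent_single)
  from linear_independent_extend[OF this, of "\<lambda>_. 1"] obtain \<phi>
    where "Vector_Spaces.linear (\<lambda>q x. of_rat q * x) (*) \<phi>" and l: "\<phi> l = 1" by auto
  then interpret f: Vector_Spaces.linear "\<lambda>(q::rat) (x::'k). of_rat q * x" "(*)" \<phi> by simp
  show thesis
    using that[of \<phi>] l f.add f.scale by (metis mult.commute)
qed

text \<open>The values of \<open>\<phi>\<close> are scalars for \<open>\<phi>\<close> itself, which
  turns each product into a square.\<close>

lemma rational_functional_sum:
  fixes \<phi> :: "'k::field_char_0 \<Rightarrow> rat"
  assumes \<phi>: "\<And>x y. \<phi> (x + y) = \<phi> x + \<phi> y" "\<And>x q. \<phi> (x * of_rat q) = \<phi> x * q"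
  shows "\<phi> (\<Sum>b\<in>A. f b * of_rat (\<phi> (f b))) = (\<Sum>b\<in>A. (\<phi> (f b))\<^sup>2)"
proof -
  have "\<phi> 0 = 0" using \<phi>(1)[of 0 0] by simp
  then show ?thesis
    by (induction A rule: infinite_finite_induct) (simp_all add: \<phi> power2_eq_square)
qed

lemma (in vector_space) linear_commutator:
  assumes "Vector_Spaces.linear scale scale X"
  shows "Vector_Spaces.linear (\<lambda>c f x. scale c (f x)) (\<lambda>c f x. scale c (f x)) (commutator X)"
proof -
  interpret fn: vector_space "\<lambda>c (f :: 'b \<Rightarrow> 'b) x. scale c (f x)" by (rule vector_space_fun)
  interpret X: Vector_Spaces.linear scale scale X by fact
  show ?thesis
    by (rule fn.linearI) (auto simp: commutator_def fun_eq_iff X.add X.scale algebra_simps)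
qed

context lie_triple_system
begin

lemma carr_closed:
  "x \<in> carr \<Longrightarrow> y \<in> carr \<Longrightarrow> x + y \<in> carr" "x \<in> carr \<Longrightarrow> scale c x \<in> carr"
  "x \<in> carr \<Longrightarrow> y \<in> carr \<Longrightarrow> x - y \<in> carr" "x \<in> carr \<Longrightarrow> - x \<in> carr" "0 \<in> carr"
  using subspace_carr
  by (simp_all add: subspace_add subspace_scale subspace_diff subspace_neg subspace_0)

lemma bracket_zero:
  "y \<in> carr \<Longrightarrow> z \<in> carr \<Longrightarrow> br 0 y z = 0" "x \<in> carr \<Longrightarrow> z \<in> carr \<Longrightarrow> br x 0 z = 0"
  "x \<in> carr \<Longrightarrow> y \<in> carr \<Longrightarrow> br x y 0 = 0"
  using br_scale1[of 0 y z 0] br_scale2[of x 0 z 0] br_scale3[of x y 0 0] by (simp_all add: carr_closed)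

lemma bracket_swap:
  assumes "x \<in> carr" "y \<in> carr" "z \<in> carr"
  shows "br y x z = - br x y z"
proof -
  have "br (x + y) (x + y) z = 0" using assms by (simp add: br_alternating carr_closed)
  moreover have "br (x + y) (x + y) z = br x (x + y) z + br y (x + y) z"
    using assms by (intro br_add1 carr_closed)
  moreover have "br x (x + y) z = br x y z" "br y (x + y) z = br y x z"
    using assms by (simp_all add: br_add2 br_alternating)
  ultimately have "br y x z + br x y z = 0" by (metis add.commute)
  then show ?thesis by (simp add: eq_neg_iff_add_eq_0)
qed

lemma bracket_rotate:
  assumes "a \<in> carr" "b \<in> carr" "z \<in> carr"
  shows "br a b z = br z b a - br z a b"
proof -
  have "br a b z + br b z a + br z a b = 0" using assms by (simp add: br_cyclic)
  then show ?thesis using bracket_swap[of z b a] assms by (simp add: algebra_simps eq_neg_iff_add_eq_0)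
qed

lemma bracket_minus:
  assumes "x \<in> carr" "y \<in> carr" "z \<in> carr"
  shows "br (- x) y z = - br x y z" "br x (- y) z = - br x y z" "br x y (- z) = - br x y z"
  using assms br_scale1[of x y z "- 1"] br_scale2[of x y z "- 1"] br_scale3[of x y z "- 1"] by simp_all

lemma bracket_diff:
  assumes "x \<in> carr" "x' \<in> carr" "y \<in> carr" "z \<in> carr"
  shows "br (x - x') y z = br x y z - br x' y z" "br y (x - x') z = br y x z - br y x' z"
    "br y z (x - x') = br y z x - br y z x'"
  using assms
  by (simp_all only: diff_conv_add_uminus br_add1 br_add2 br_add3 bracket_minus carr_closed)

end

text \<open>
  Extending the bracket of a finite dimensional system by \<open>0\<close> on a linear complement makes it
  a bracket on the whole ambient space, so that all operators below are total linear maps;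
  \<open>p\<close> is the projection along this complement.
\<close>

locale extended_lts = lie_triple_system scale UNIV br
  for scale :: "'k::{alg_closed_field, field_char_0} \<Rightarrow> 'v::ab_group_add \<Rightarrow> 'v"
    and br :: "'v \<Rightarrow> 'v \<Rightarrow> 'v \<Rightarrow> 'v" +
  fixes B :: "'v set" and p :: "'v \<Rightarrow> 'v"
  assumes finite_B: "finite B" and indep_B: "independent B"
    and br_in_span: "br x y z \<in> span B"
    and linear_p: "Vector_Spaces.linear scale scale p"
    and p_in_span: "p x \<in> span B"
    and p_id: "x \<in> span B \<Longrightarrow> p x = x"
    and br_p: "br (p x) (p y) (p z) = br x y z"
begin

section \<open>Derivations of the extended system\<close>

lemma br_add: "br (x + x') y z = br x y z + br x' y z"
    "br x (y + y') z = br x y z + br x y' z" "br x y (z + z') = br x y z + br x y z'"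
  and br_scale: "br (scale c x) y z = scale c (br x y z)"
    "br x (scale c y) z = scale c (br x y z)" "br x y (scale c z) = scale c (br x y z)"
  by (simp_all add: br_add1 br_add2 br_add3 br_scale1 br_scale2 br_scale3)

lemma linear_br:
  "Vector_Spaces.linear scale scale (\<lambda>x. br x y z)"
  "Vector_Spaces.linear scale scale (\<lambda>y. br x y z)"
  "Vector_Spaces.linear scale scale (\<lambda>z. br x y z)"
  by (rule linearI; simp add: br_add br_scale)+

lemma br_0 [simp]: "br 0 y z = 0" "br x 0 z = 0" "br x y 0 = 0"
  by (simp_all add: bracket_zero)

lemma br_diff: "br (x - x') y z = br x y z - br x' y z"
    "br x (y - y') z = br x y z - br x y' z" "br x y (z - z') = br x y z - br x y z'"
  by (simp_all add: bracket_diff)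

lemma br_swap: "br y x z = - br x y z"
  by (rule bracket_swap) auto

lemma br_rotate: "br a b z = br z b a - br z a b"
  by (rule bracket_rotate) auto

text \<open>The condition with \<open>p\<close> says that \<open>X\<close> is 0 on the complement
  along which \<open>p\<close> projects. These are thus the derivations of the finite dimensional
  system, extended by 0.\<close>

definition derivation :: "('v \<Rightarrow> 'v) \<Rightarrow> bool" where
  "derivation X \<longleftrightarrow> Vector_Spaces.linear scale scale X \<and> (\<forall>x. X x \<in> span B) \<and>
    (\<forall>x. X (p x) = X x) \<and>
    (\<forall>x y z. X (br x y z) = br (X x) y z + br x (X y) z + br x y (X z))"

text \<open>The trace of \<open>R(u,v)\<close>; symmetrized in \<open>u\<close> and \<open>v\<close>
  it is the form rho.\<close>

definition right_trace :: "'v \<Rightarrow> 'v \<Rightarrow> 'k" where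
  "right_trace u v = trace B (\<lambda>z. br z u v)"

interpretation fn: vector_space "\<lambda>c (f :: 'v \<Rightarrow> 'v) x. scale c (f x)"
  by (rule vector_space_fun)

lemma linear_derivation: "derivation X \<Longrightarrow> Vector_Spaces.linear scale scale X"
  by (simp add: derivation_def)

lemma derivation_br: "derivation (br a b)"
proof -
  have "br x y (p z) = br x y z" for x y z
    by (metis br_p p_id p_in_span)
  then show ?thesis
    using linear_br(3) br_in_span br_derivation[of a b, OF UNIV_I UNIV_I UNIV_I UNIV_I UNIV_I]
    unfolding derivation_def by blast
qed

lemma derivation_0: "derivation 0"
  using linearI[of "0 :: 'v \<Rightarrow> 'v"] by (simp add: derivation_def span_zero)

lemma derivation_add_scale:
  assumes "derivation X" "derivation Y"
  shows "derivation ((\<lambda>v. scale c (X v)) + Y)"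
proof -
  interpret X: Vector_Spaces.linear scale scale X using assms by (simp add: derivation_def)
  interpret Y: Vector_Spaces.linear scale scale Y using assms by (simp add: derivation_def)
  have "Vector_Spaces.linear scale scale ((\<lambda>v. scale c (X v)) + Y)"
    by (rule linearI) (auto simp: X.add X.scale Y.add Y.scale algebra_simps)
  then show ?thesis
    using assms by (auto simp: derivation_def br_add br_scale algebra_simps intro!: span_add span_scale)
qed

lemma derivation_span:
  assumes "X \<in> fn.span A" "\<And>Y. Y \<in> A \<Longrightarrow> derivation Y"
  shows "derivation X"
  using assms(1)
proof (induction rule: fn.span_induct_alt)
  case base
  show ?case using derivation_0 by (simp add: zero_fun_def)
next
  case (step c x y)
  then show ?case using derivation_add_scale[OF assms(2)] by blast
qed

lemma commutator_br:
  assumes "derivation X"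
  shows "commutator X (br a b) = br (X a) b + br a (X b)"
  using assms by (auto simp: commutator_def derivation_def fun_eq_iff)

text \<open>The even part of the standard embedding, with \<open>commutator\<close> as its Lie
  bracket; \<open>span B\<close> is the odd part.\<close>

definition inner :: "('v \<Rightarrow> 'v) set" where
  "inner = fn.span {br a b | a b. True}"

lemma br_inner: "br a b \<in> inner"
  unfolding inner_def by (rule fn.span_base) blast

lemma inner_derivation: "X \<in> inner \<Longrightarrow> derivation X"
  unfolding inner_def using derivation_br by (erule_tac derivation_span) blast

lemma commutator_inner:
  assumes X: "derivation X" and "Z \<in> inner"
  shows "commutator X Z \<in> inner"
  using assms(2) unfolding inner_def
proof (induction rule: fn.span_induct_alt)
  case base
  interpret X: Vector_Spaces.linear scale scale X using X by (rule linear_derivation)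
  have "commutator X 0 = 0" by (simp add: commutator_def fun_eq_iff)
  then show ?case using fn.span_zero by (simp add: zero_fun_def)
next
  case (step c x y)
  interpret C: Vector_Spaces.linear "\<lambda>c (f :: 'v \<Rightarrow> 'v) x. scale c (f x)"
      "\<lambda>c (f :: 'v \<Rightarrow> 'v) x. scale c (f x)" "commutator X"
    using X by (intro linear_commutator linear_derivation)
  obtain a b where x: "x = br a b" using step(1) by blast
  have "commutator X x \<in> inner"
    using br_inner unfolding x commutator_br[OF X] inner_def by (intro fn.span_add)
  then show ?case
    using step.IH unfolding C.add C.scale inner_def by (intro fn.span_add fn.span_scale)
qed

lemma br_fun_add: "br (x + x') y = br x y + br x' y" "br x (y + y') = br x y + br x y'"
  by (auto simp: fun_eq_iff br_add)

lemma br_fun_scale: "br (scale c x) y = (\<lambda>z. scale c (br x y z))" "br x (scale c y) = (\<lambda>z. scale c (br x y z))"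
  by (auto simp: fun_eq_iff br_scale)

lemma br_in_fn_span:
  assumes "x \<in> span U" "y \<in> span V"
  shows "br x y \<in> fn.span {br u v | u v. u \<in> U \<and> v \<in> V}"
  using assms(1)
proof (induction rule: span_induct_alt)
  case base
  have "br 0 y = 0" by (simp add: fun_eq_iff)
  then show ?case by (simp only: fn.span_zero)
next
  case (step c x x')
  have "br x y \<in> fn.span {br u v | u v. u \<in> U \<and> v \<in> V}"
    using assms(2)
  proof (induction rule: span_induct_alt)
    case base
    have "br x 0 = 0" by (simp add: fun_eq_iff)
    then show ?case by (simp only: fn.span_zero)
  next
    case (step d y y')
    have "br x y \<in> fn.span {br u v | u v. u \<in> U \<and> v \<in> V}"
      using \<open>x \<in> U\<close> step by (intro fn.span_base) blast
    then show ?case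
      using step unfolding br_fun_add br_fun_scale by (intro fn.span_add fn.span_scale)
  qed
  then show ?case
    using step unfolding br_fun_add br_fun_scale by (intro fn.span_add fn.span_scale)
qed

lemma br_p_fun: "br (p a) (p b) = br a b"
  by (metis br_p p_id p_in_span ext)

text \<open>Besides \<open>B\<close> itself, a set of generalized eigenvectors of a derivation
  \<open>X\<close> is used for \<open>U\<close>; it makes \<open>inner\<close> a span of generalized
  eigenvectors of \<open>commutator X\<close>.\<close>

lemma inner_eq_span:
  assumes "span U = span B"
  shows "inner = fn.span {br u v | u v. u \<in> U \<and> v \<in> U}"
proof -
  have "br a b \<in> fn.span {br u v | u v. u \<in> U \<and> v \<in> U}" for a b
    using br_in_fn_span[of "p a" U "p b" U] p_in_span assms by (simp add: br_p_fun)
  then have "inner \<subseteq> fn.span {br u v | u v. u \<in> U \<and> v \<in> U}"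
    unfolding inner_def by (intro fn.span_minimal) auto
  moreover have "fn.span {br u v | u v. u \<in> U \<and> v \<in> U} \<subseteq> inner"
    unfolding inner_def by (rule fn.span_mono) blast
  ultimately show ?thesis by blast
qed

lemma inner_basis:
  obtains C where "finite C" "fn.independent C" "fn.span C = inner"
proof -
  let ?F = "{br u v | u v. u \<in> B \<and> v \<in> B}"
  have "?F = (\<lambda>(u, v). br u v) ` (B \<times> B)" by auto
  then have F: "finite ?F" using finite_B by simp
  obtain C where C: "C \<subseteq> ?F" "fn.independent C" "?F \<subseteq> fn.span C"
    using fn.maximal_independent_subset[of ?F] by blast
  have "fn.span C = fn.span ?F"
    using C fn.span_mono[OF C(1)] fn.span_minimal[OF C(3)] by auto
  also have "\<dots> = inner" by (rule inner_eq_span[OF refl, symmetric])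
  finally show thesis using finite_subset[OF C(1) F] C(2) by (intro that)
qed

text \<open>The commutator of \<open>X\<close> with \<open>R(u,v)\<close> is
  \<open>R(X u, v) + R(u, X v)\<close>, and commutators have trace 0.\<close>

lemma right_trace_derivation:
  assumes X: "derivation X"
  shows "right_trace (X u) v + right_trace u (X v) = 0"
proof -
  interpret X: Vector_Spaces.linear scale scale X using X by (rule linear_derivation)
  interpret vector_space_pair scale scale ..
  have "trace B (X \<circ> (\<lambda>z. br z u v)) = trace B ((\<lambda>z. br z u v) \<circ> X)"
    using X br_in_span by (intro trace_commute linear_br finite_B indep_B) (auto simp: derivation_def)
  also have "X \<circ> (\<lambda>z. br z u v) = (\<lambda>z. br (X z) u v + (br z (X u) v + br z u (X v)))"
    using X by (auto simp: derivation_def fun_eq_iff)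
  also have "trace B \<dots> = trace B (\<lambda>z. br (X z) u v) + (right_trace (X u) v + right_trace u (X v))"
    using indep_B br_in_span by (simp add: right_trace_def trace_add span_add image_subset_iff)
  finally show ?thesis by (simp add: o_def)
qed

text \<open>The Killing form of the standard embedding, evaluated at the even elements
  \<open>br a b\<close> and \<open>E\<close>: by cyclicity of traces all terms but two cancel.\<close>

lemma killing_br:
  assumes C: "finite C" "fn.independent C" "fn.span C = inner" and E: "derivation E"
  shows "trace B (br a b \<circ> E) + fn.trace C (commutator (br a b) \<circ> commutator E)
    = - (right_trace a (E b) + right_trace (E b) a)"
proof -
  interpret E: Vector_Spaces.linear scale scale E using E by (rule linear_derivation)
  interpret vp: vector_space_pair "\<lambda>c (f :: 'v \<Rightarrow> 'v) x. scale c (f x)" scale ..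
  interpret vv: vector_space_pair scale scale ..
  interpret C: Vector_Spaces.linear "\<lambda>c (f :: 'v \<Rightarrow> 'v) x. scale c (f x)"
      "\<lambda>c (f :: 'v \<Rightarrow> 'v) x. scale c (f x)" "commutator E"
    using E by (intro linear_commutator linear_derivation)
  have Espan: "E x \<in> span B" for x using E by (simp add: derivation_def)
  have inC: "Z \<in> inner" if "Z \<in> C" for Z using that C fn.span_base by blast
  have Z_span: "Z v \<in> span B" if "Z \<in> inner" for Z v
    using inner_derivation[OF that] by (simp add: derivation_def)
  have ev: "Vector_Spaces.linear (\<lambda>c f x. scale c (f x)) scale (\<lambda>Z. commutator E Z w)" for w
    by (simp add: Vector_Spaces.linear_iff vector_space_axioms vector_space_fun C.add C.scale)
  have lin1: "Vector_Spaces.linear scale (\<lambda>c f x. scale c (f x)) (\<lambda>t. br t w)" for w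
    by (simp add: Vector_Spaces.linear_iff vector_space_axioms vector_space_fun br_fun_add br_fun_scale)
  have lin2: "Vector_Spaces.linear scale (\<lambda>c f x. scale c (f x)) (\<lambda>t. br w t)" for w
    by (simp add: Vector_Spaces.linear_iff vector_space_axioms vector_space_fun br_fun_add br_fun_scale)
  have ev_in: "commutator E Z w \<in> span B" if "Z \<in> C" for Z w
    using Z_span commutator_inner[OF E inC[OF that]] by blast
  \<comment> \<open>Each summand of the double commutator factors through \<open>span B\<close>:
    evaluate \<open>commutator E Z\<close> at \<open>a\<close>, then apply
    \<open>\<lambda>t. br t b\<close>. Exchanging the factors turns a trace on the inner derivations
    into one on \<open>span B\<close>.\<close>
  have t1: "fn.trace C ((\<lambda>t. br t b) \<circ> (\<lambda>Z. commutator E Z a))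
      = trace B ((\<lambda>Z. commutator E Z a) \<circ> (\<lambda>t. br t b))"
    by (rule vp.trace_commute[OF C(1,2) finite_B indep_B ev _ lin1]) (auto simp: ev_in C br_inner)
  have t2: "fn.trace C ((\<lambda>t. br a t) \<circ> (\<lambda>Z. commutator E Z b))
      = trace B ((\<lambda>Z. commutator E Z b) \<circ> (\<lambda>t. br a t))"
    by (rule vp.trace_commute[OF C(1,2) finite_B indep_B ev _ lin2]) (auto simp: ev_in C br_inner)
  have "commutator (br a b) (commutator E Z)
      = - (br (commutator E Z a) b + br a (commutator E Z b))" if "Z \<in> C" for Z
  proof -
    have "derivation (commutator E Z)"
      using that by (intro inner_derivation commutator_inner[OF E] inC)
    from commutator_br[OF this, of a b] show ?thesis
      by (auto simp: commutator_def fun_eq_iff algebra_simps)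
  qed
  then have "fn.trace C (commutator (br a b) \<circ> commutator E)
      = fn.trace C (\<lambda>Z. (\<lambda>v. scale (- 1) ((br (commutator E Z a) b + br a (commutator E Z b)) v)))"
    by (intro fn.trace_cong) (simp add: fun_eq_iff)
  also have "\<dots> = - 1 * fn.trace C (\<lambda>Z. br (commutator E Z a) b + br a (commutator E Z b))"
    using C br_inner by (intro fn.trace_scale) (auto intro!: fn.span_add simp del: plus_fun_apply)
  also have "fn.trace C (\<lambda>Z. br (commutator E Z a) b + br a (commutator E Z b))
      = fn.trace C (\<lambda>Z. br (commutator E Z a) b) + fn.trace C (\<lambda>Z. br a (commutator E Z b))"
    using C br_inner by (intro fn.trace_add) auto
  also have "fn.trace C (\<lambda>Z. br (commutator E Z a) b)
      = trace B (\<lambda>t. E (br t b a) - br t b (E a))"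
    using t1 by (simp add: o_def commutator_def)
  also have "\<dots> = trace B (\<lambda>t. E (br t b a)) - right_trace b (E a)"
    unfolding right_trace_def by (intro trace_diff) (auto simp: indep_B br_in_span Espan)
  also have "fn.trace C (\<lambda>Z. br a (commutator E Z b))
      = trace B (\<lambda>t. (br t a (E b) - E (br t a b)))"
    using t2 by (simp add: o_def commutator_def br_swap[of a] E.neg)
  also have "\<dots> = right_trace a (E b) - trace B (\<lambda>t. E (br t a b))"
    unfolding right_trace_def by (intro trace_diff) (auto simp: indep_B br_in_span Espan)
  finally have T: "fn.trace C (commutator (br a b) \<circ> commutator E) =
      - (trace B (\<lambda>t. E (br t b a)) - right_trace b (E a) + (right_trace a (E b) - trace B (\<lambda>t. E (br t a b))))"
    by (simp add: o_def)
  have cyc: "trace B (\<lambda>t. E (br t u v)) = trace B (\<lambda>t. br (E t) u v)" for u v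
  proof -
    have "trace B (E \<circ> (\<lambda>t. br t u v)) = trace B ((\<lambda>t. br t u v) \<circ> E)"
      by (intro vv.trace_commute linear_br finite_B indep_B linear_derivation[OF E])
        (auto simp: br_in_span Espan)
    then show ?thesis by (simp add: o_def)
  qed
  have "trace B (br a b \<circ> E) = trace B (\<lambda>t. br (E t) b a - br (E t) a b)"
    by (intro trace_cong) (simp add: br_rotate[of a b])
  also have "\<dots> = trace B (\<lambda>t. br (E t) b a) - trace B (\<lambda>t. br (E t) a b)"
    by (intro trace_diff) (auto simp: indep_B br_in_span)
  finally have "trace B (br a b \<circ> E) + fn.trace C (commutator (br a b) \<circ> commutator E)
      = right_trace b (E a) - right_trace a (E b)"
    by (simp add: T cyc)
  \<comment> \<open>\<open>E\<close> is moved from \<open>a\<close> to \<open>b\<close>, so that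
    \<open>a\<close> stands alone as an argument of the form and its orthogonality can be
    used.\<close>
  also have "right_trace b (E a) = - right_trace (E b) a"
    using right_trace_derivation[OF E, of b a] by (simp add: eq_neg_iff_add_eq_0 add.commute)
  finally show ?thesis by (simp add: o_def)
qed

text \<open>By the product rule, \<open>X - (l + m + n)\<close> applied to \<open>br x y z\<close>
  gives three brackets, in each of which one argument is shifted by its own eigenvalue; so the sum
  of the three exponents goes down.\<close>

lemma gen_eig_br:
  assumes X: "derivation X" and "x \<in> gen_eig X l" "y \<in> gen_eig X m" "z \<in> gen_eig X n"
  shows "br x y z \<in> gen_eig X (l + m + n)"
proof -
  let ?Y = "\<lambda>l v. X v - scale l v"
  note sub = subspace_gen_eig[OF linear_derivation[OF X]]
  have "br x y z \<in> gen_eig X (l + m + n)"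
    if "(?Y l ^^ i) x = 0" "(?Y m ^^ j) y = 0" "(?Y n ^^ k) z = 0" for i j k
    using that
  proof (induction "i + j + k" arbitrary: i j k x y z rule: less_induct)
    case less
    show ?case
    proof (cases "i = 0 \<or> j = 0 \<or> k = 0")
      case True
      then show ?thesis using less.prems subspace_0[OF sub] by auto
    next
      case False
      then obtain i' j' k' where s: "i = Suc i'" "j = Suc j'" "k = Suc k'"
        by (metis not0_implies_Suc)
      have "?Y (l + m + n) (br x y z) = br (?Y l x) y z + br x (?Y m y) z + br x y (?Y n z)"
        using X by (simp add: derivation_def br_diff br_scale algebra_simps)
      moreover have "br (?Y l x) y z \<in> gen_eig X (l + m + n)"
        using less.prems s
        by (intro less.hyps[of i' j k]) (simp_all add: funpow_Suc_right del: funpow.simps)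
      moreover have "br x (?Y m y) z \<in> gen_eig X (l + m + n)"
        using less.prems s
        by (intro less.hyps[of i j' k]) (simp_all add: funpow_Suc_right del: funpow.simps)
      moreover have "br x y (?Y n z) \<in> gen_eig X (l + m + n)"
        using less.prems s
        by (intro less.hyps[of i j k']) (simp_all add: funpow_Suc_right del: funpow.simps)
      ultimately have "?Y (l + m + n) (br x y z) \<in> gen_eig X (l + m + n)"
        using subspace_add[OF sub] by metis
      then show ?thesis by (rule gen_eig_shift_D)
    qed
  qed
  then show ?thesis using assms(2-4) by (auto simp: gen_eig_def)
qed

lemma gen_eig_commutator_br:
  assumes X: "derivation X" and "x \<in> gen_eig X l" "y \<in> gen_eig X m"
  shows "br x y \<in> fn.gen_eig (commutator X) (l + m)"
proof -
  let ?Y = "\<lambda>l v. X v - scale l v"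
  note sub = fn.subspace_gen_eig[OF linear_commutator[OF linear_derivation[OF X]]]
  have "br x y \<in> fn.gen_eig (commutator X) (l + m)"
    if "(?Y l ^^ i) x = 0" "(?Y m ^^ j) y = 0" for i j
    using that
  proof (induction "i + j" arbitrary: i j x y rule: less_induct)
    case less
    show ?case
    proof (cases "i = 0 \<or> j = 0")
      case True
      then have "br x y = 0" using less.prems by (auto simp: fun_eq_iff)
      then show ?thesis by (simp only: fn.subspace_0[OF sub])
    next
      case False
      then obtain i' j' where s: "i = Suc i'" "j = Suc j'" by (metis not0_implies_Suc)
      have "commutator X (br x y) - (\<lambda>v. scale (l + m) (br x y v)) = br (?Y l x) y + br x (?Y m y)"
        by (simp add: commutator_br[OF X] fun_eq_iff br_diff br_scale algebra_simps)
      moreover have "br (?Y l x) y \<in> fn.gen_eig (commutator X) (l + m)"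
        using less.prems s
        by (intro less.hyps[of i' j]) (simp_all add: funpow_Suc_right del: funpow.simps)
      moreover have "br x (?Y m y) \<in> fn.gen_eig (commutator X) (l + m)"
        using less.prems s
        by (intro less.hyps[of i j']) (simp_all add: funpow_Suc_right del: funpow.simps)
      ultimately have "commutator X (br x y) - (\<lambda>v. scale (l + m) (br x y v))
          \<in> fn.gen_eig (commutator X) (l + m)"
        using fn.subspace_add[OF sub] by metis
      then show ?thesis by (rule fn.gen_eig_shift_D)
    qed
  qed
  then show ?thesis using assms(2,3) by (auto simp: gen_eig_def)
qed

lemma span_trilinear_eq:
  assumes f: "\<And>y z. Vector_Spaces.linear scale scale (\<lambda>x. f x y z)"
      "\<And>x z. Vector_Spaces.linear scale scale (\<lambda>y. f x y z)"
      "\<And>x y. Vector_Spaces.linear scale scale (\<lambda>z. f x y z)"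
    and U: "\<And>x y z. x \<in> U \<Longrightarrow> y \<in> U \<Longrightarrow> z \<in> U \<Longrightarrow> f x y z = 0"
    and x: "x \<in> span U" "y \<in> span U" "z \<in> span U"
  shows "f x y z = 0"
proof -
  interpret vector_space_pair scale scale ..
  have lin0: "Vector_Spaces.linear scale scale (\<lambda>_. 0)" by (rule linearI) auto
  have 1: "f x y z = 0" if "x \<in> U" "y \<in> U" for x y
    using linear_eq_on[OF f(3) lin0 x(3)] U[OF that] by blast
  have 2: "f x y z = 0" if "x \<in> U" for x
    using linear_eq_on[OF f(2) lin0 x(2)] 1[OF that] by blast
  show ?thesis
    using linear_eq_on[OF f(1) lin0 x(1)] 2 by blast
qed

text \<open>The failure of the product rule is trilinear, so generalized eigenvectors suffice. There
  the bracket has eigenvalue \<open>l + m + n\<close>, and additivity of \<open>\<psi>\<close> is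
  precisely the product rule. Composition with \<open>p\<close> makes the operator 0 on the
  complement.\<close>

lemma derivationI_gen_eig:
  assumes X: "derivation X"
    and E0: "Vector_Spaces.linear scale scale E0" "E0 ` span B \<subseteq> span B"
    and eig: "\<And>l v. v \<in> gen_eig X l \<Longrightarrow> v \<in> span B \<Longrightarrow> E0 v = scale (\<psi> l) v"
    and \<psi>: "\<And>l m. \<psi> (l + m) = \<psi> l + \<psi> m"
    and span: "span B = span (\<Union>l. gen_eig X l \<inter> span B)"
  shows "derivation (E0 \<circ> p)"
proof -
  interpret E0: Vector_Spaces.linear scale scale E0 by fact
  interpret p: Vector_Spaces.linear scale scale p by (rule linear_p)
  define E where "E = E0 \<circ> p"
  have E: "Vector_Spaces.linear scale scale E"
    unfolding E_def by (rule linearI) (auto simp: E0.add E0.scale p.add p.scale)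
  interpret E: Vector_Spaces.linear scale scale E by fact
  have E_eig: "E v = scale (\<psi> l) v" if "v \<in> gen_eig X l" "v \<in> span B" for v l
    using eig[OF that] that by (simp add: E_def p_id)
  have Ep: "E (p x) = E x" for x by (simp add: E_def p_id p_in_span)
  have Espan: "E x \<in> span B" for x using E0(2) p_in_span by (auto simp: E_def)
  let ?U = "\<Union>l. gen_eig X l \<inter> span B"
  define d where "d = (\<lambda>x y z. E (br x y z) - (br (E x) y z + br x (E y) z + br x y (E z)))"
  have d0: "d x y z = 0" if "x \<in> span ?U" "y \<in> span ?U" "z \<in> span ?U" for x y z
  proof (rule span_trilinear_eq[OF _ _ _ _ that])
    fix x y z assume "x \<in> ?U" "y \<in> ?U" "z \<in> ?U"
    then obtain l m n where "x \<in> gen_eig X l" "y \<in> gen_eig X m" "z \<in> gen_eig X n"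
      and span: "x \<in> span B" "y \<in> span B" "z \<in> span B" by auto
    moreover from this have "br x y z \<in> gen_eig X (l + m + n)" by (intro gen_eig_br[OF X])
    ultimately show "d x y z = 0"
      by (simp add: d_def E_eig br_in_span \<psi> br_scale scale_left_distrib)
  qed (rule linearI; simp add: d_def E.add E.scale br_add br_scale algebra_simps)+
  have "E (br x y z) = br (E x) y z + br x (E y) z + br x y (E z)" for x y z
  proof -
    have "p v \<in> span ?U" for v using p_in_span span by blast
    then have "d (p x) (p y) (p z) = 0" by (intro d0)
    then have "E (br (p x) (p y) (p z)) = br (E x) (p y) (p z) + br (p x) (E y) (p z) + br (p x) (p y) (E z)"
      by (simp add: d_def Ep)
    moreover have "br (p (E x)) (p y) (p z) = br (E x) y z" "br (p x) (p (E y)) (p z) = br x (E y) z"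
      "br (p x) (p y) (p (E z)) = br x y (E z)" by (rule br_p)+
    ultimately show ?thesis by (simp only: br_p p_id[OF Espan])
  qed
  then show ?thesis
    unfolding derivation_def E_def[symmetric] using E Espan Ep by simp
qed

text \<open>The functional is chosen anew for each \<open>l \<noteq> 0\<close>, with
  \<open>\<phi> l = 1\<close>. Then \<open>E\<close> is the identity on the generalized eigenspace
  for \<open>l\<close>, while the vanishing sum of squares makes \<open>E\<close> zero on all of
  \<open>span B\<close>; so this eigenspace is 0 there.\<close>

lemma derivation_nilpotent:
  assumes X: "derivation X" "X \<in> inner"
    and C: "finite C" "fn.independent C" "fn.span C = inner"
    and killing: "\<And>E. derivation E \<Longrightarrow>
      trace B (X \<circ> E) + fn.trace C (commutator X \<circ> commutator E) = 0"
  shows "\<exists>n. \<forall>v. (X ^^ n) v = 0"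
proof -
  have linX: "Vector_Spaces.linear scale scale X" using X(1) by (rule linear_derivation)
  interpret X: Vector_Spaces.linear scale scale X by (rule linX)
  interpret vv: vector_space_pair scale scale ..
  interpret vp: vector_space_pair "\<lambda>c (f :: 'v \<Rightarrow> 'v) x. scale c (f x)"
    "\<lambda>c (f :: 'v \<Rightarrow> 'v) x. scale c (f x)" ..
  have XB: "X ` span B \<subseteq> span B" using X(1) by (auto simp: derivation_def)
  let ?U = "\<Union>l. gen_eig X l \<inter> span B"
  have spanU: "span B = span ?U"
    by (rule gen_eig_span[OF vector_space_axioms linX XB finite_B])
  have zero: "v = 0" if v: "v \<in> gen_eig X l" "v \<in> span B" and "l \<noteq> 0" for v l
  proof -
    obtain \<phi> :: "'k \<Rightarrow> rat" where \<phi>: "\<phi> l = 1" "\<And>x y. \<phi> (x + y) = \<phi> x + \<phi> y"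
      "\<And>x q. \<phi> (x * of_rat q) = \<phi> x * q"
      using rational_functional[OF \<open>l \<noteq> 0\<close>] by blast
    define \<psi> where "\<psi> = (\<lambda>x. of_rat (\<phi> x) :: 'k)"
    have \<psi>_add: "\<psi> (x + y) = \<psi> x + \<psi> y" for x y by (simp add: \<psi>_def \<phi> of_rat_add)
    obtain E0 where E0: "Vector_Spaces.linear scale scale E0" "E0 ` span B \<subseteq> span B"
      "\<And>l v. v \<in> gen_eig X l \<Longrightarrow> v \<in> span B \<Longrightarrow> E0 v = scale (\<psi> l) v"
      using eigenspace_operator[OF linX subspace_span spanU] by blast
    define E where "E = E0 \<circ> p"
    have E: "derivation E"
      unfolding E_def by (rule derivationI_gen_eig[OF X(1) E0 \<psi>_add spanU])
    have linE: "Vector_Spaces.linear scale scale E" using E by (rule linear_derivation)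
    interpret E: Vector_Spaces.linear scale scale E by (rule linE)
    have E_eig: "E v = scale (\<psi> l) v" if "v \<in> gen_eig X l" "v \<in> span B" for v l
      using E0(3)[OF that] that by (simp add: E_def p_id)
    \<comment> \<open>\<open>E\<close> is a scalar on each generalized eigenspace, and
      \<open>X\<close> preserves these.\<close>
    have comm: "X (E v) = E (X v)" for v
    proof -
      have "(X \<circ> E) (p v) = (E \<circ> X) (p v)"
      proof (rule vv.linear_eq_on[where f = "X \<circ> E" and g = "E \<circ> X" and x = "p v" and B = ?U])
        show "p v \<in> span ?U" using p_in_span spanU by blast
        fix u assume "u \<in> ?U"
        then obtain m where u: "u \<in> gen_eig X m" "u \<in> span B" by blast
        moreover have "X u \<in> gen_eig X m" using gen_eig_shift[OF linX u(1), of 0] by simp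
        moreover have "X u \<in> span B" using u XB by blast
        ultimately show "(X \<circ> E) u = (E \<circ> X) u" by (simp add: E_eig X.scale)
      qed (auto intro!: linearI simp: X.add E.add X.scale E.scale)
      then show ?thesis using X(1) E by (simp add: derivation_def)
    qed
    obtain C1 l1 where C1: "finite C1" "span C1 = span B"
      "\<And>b. b \<in> C1 \<Longrightarrow> E b = scale (\<psi> (l1 b)) b"
      "trace B (X \<circ> E) = (\<Sum>b\<in>C1. l1 b * \<psi> (l1 b))"
    proof (rule trace_triangular[OF finite_B indep_B linX XB linE])
      show "?U \<subseteq> span B" by blast
      show "B \<subseteq> span ?U" unfolding spanU[symmetric] by (rule span_superset)
    qed (use comm E_eig in auto)
    have "Vector_Spaces.linear (\<lambda>c f x. scale c (f x)) (\<lambda>c f x. scale c (f x)) (commutator X)"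
      "Vector_Spaces.linear (\<lambda>c f x. scale c (f x)) (\<lambda>c f x. scale c (f x)) (commutator E)"
      by (intro linear_commutator linX linE)+
    note lin_comm = this
    let ?V = "{br u v | u v. u \<in> ?U \<and> v \<in> ?U}"
    have innerV: "inner = fn.span ?V" by (rule inner_eq_span[OF spanU[symmetric]])
    \<comment> \<open>The same triangularization for the two commutator maps on
      \<open>inner\<close>, with the brackets \<open>br u v\<close> of generalized eigenvectors as
      spanning set. Its eigenvalues will contribute further squares of rationals, which are
      nonnegative.\<close>
    have "\<exists>(C2 :: ('v \<Rightarrow> 'v) set) l2. fn.trace C (commutator X \<circ> commutator E) = (\<Sum>b\<in>C2. l2 b * \<psi> (l2 b))"
    proof (rule fn.trace_triangular[OF C(1,2) lin_comm(1) _ lin_comm(2)])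
      show "commutator X ` fn.span C \<subseteq> fn.span C"
        using commutator_inner[OF X(1)] by (auto simp: C(3))
      show "?V \<subseteq> fn.span C" using br_inner by (auto simp: C(3))
      show "C \<subseteq> fn.span ?V" using fn.span_superset[of C] C(3) innerV by simp
      show "commutator X (commutator E Z) = commutator E (commutator X Z)" if "Z \<in> fn.span C" for Z
      proof -
        interpret Z: Vector_Spaces.linear scale scale Z
          using that by (intro linear_derivation inner_derivation) (simp add: C(3))
        show ?thesis by (auto simp: commutator_def fun_eq_iff X.diff E.diff Z.diff comm)
      qed
      fix Z assume "Z \<in> ?V"
      then obtain u v l m where Z: "Z = br u v" and u: "u \<in> gen_eig X l" "u \<in> span B"
        and v: "v \<in> gen_eig X m" "v \<in> span B" by blast
      have "Z \<in> fn.gen_eig (commutator X) (l + m)"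
        unfolding Z by (rule gen_eig_commutator_br[OF X(1) u(1) v(1)])
      moreover have "commutator E Z = (\<lambda>x. scale (\<psi> (l + m)) (Z x))"
        by (simp add: Z commutator_br[OF E] E_eig[OF u] E_eig[OF v] \<psi>_add fun_eq_iff br_scale
            scale_left_distrib)
      ultimately show "\<exists>l. Z \<in> fn.gen_eig (commutator X) l \<and> commutator E Z = (\<lambda>x. scale (\<psi> l) (Z x))"
        by blast
    qed (rule exI, rule exI, assumption)
    then obtain C2 :: "('v \<Rightarrow> 'v) set" and l2
      where C2: "fn.trace C (commutator X \<circ> commutator E) = (\<Sum>b\<in>C2. l2 b * \<psi> (l2 b))"
      by blast
    have "(\<Sum>b\<in>C1. l1 b * \<psi> (l1 b)) + (\<Sum>b\<in>C2. l2 b * \<psi> (l2 b)) = 0"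
      using killing[OF E] by (simp only: C1(4) C2)
    moreover have "\<phi> 0 = 0" using \<phi>(2)[of 0 0] by simp
    ultimately have "\<phi> ((\<Sum>b\<in>C1. l1 b * \<psi> (l1 b)) + (\<Sum>b\<in>C2. l2 b * \<psi> (l2 b))) = 0"
      by simp
    then have "(\<Sum>b\<in>C1. (\<phi> (l1 b))\<^sup>2) + (\<Sum>b\<in>C2. (\<phi> (l2 b))\<^sup>2) = 0"
      unfolding \<psi>_def \<phi>(2) rational_functional_sum[of \<phi>, OF \<phi>(2,3)] .
    moreover have "(\<Sum>b\<in>C1. (\<phi> (l1 b))\<^sup>2) \<ge> 0" "(\<Sum>b\<in>C2. (\<phi> (l2 b))\<^sup>2) \<ge> 0"
      by (simp_all add: sum_nonneg)
    ultimately have "(\<Sum>b\<in>C1. (\<phi> (l1 b))\<^sup>2) = 0" by linarith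
    then have "\<phi> (l1 b) = 0" if "b \<in> C1" for b
      using that C1(1) by (simp add: sum_nonneg_eq_0_iff)
    then have E_C1: "E b = 0" if "b \<in> C1" for b using C1(3) that by (simp add: \<psi>_def)
    have "E v = 0" if "v \<in> span C1" for v
      using that by (induction rule: span_induct_alt) (simp_all add: E.add E.scale E_C1)
    then have "E v = 0" using v(2) C1(2) by simp
    then show "v = 0" using E_eig[OF v] \<phi>(1) by (simp add: \<psi>_def)
  qed
  have "span B \<subseteq> gen_eig X 0"
  proof -
    have "?U \<subseteq> gen_eig X 0"
      using zero subspace_0[OF subspace_gen_eig[OF linX]] by auto
    then have "span ?U \<subseteq> gen_eig X 0" by (rule span_minimal) (rule subspace_gen_eig[OF linX])
    then show ?thesis by (rule ord_eq_le_trans[OF spanU])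
  qed
  then have "\<forall>b\<in>B. \<exists>n. (X ^^ n) b = 0"
    using span_superset[of B] by (auto simp: gen_eig_def)
  then obtain n where n: "\<And>b. b \<in> B \<Longrightarrow> (X ^^ n b) b = 0" by metis
  define N where "N = Max (n ` B)"
  have "(X ^^ N) v = 0" if "v \<in> span B" for v
  proof -
    interpret XN: Vector_Spaces.linear scale scale "X ^^ N" by (rule linear_funpow[OF linX])
    have XNb: "(X ^^ N) b = 0" if "b \<in> B" for b
      using funpow_zero_mono[OF linX n[OF that], of N] that finite_B by (simp add: N_def)
    show ?thesis
      using that
      by (induction rule: span_induct_alt) (simp_all add: XN.add XN.scale XNb)
  qed
  moreover have "X v \<in> span B" for v using X(1) by (simp add: derivation_def)
  \<comment> \<open>\<open>X ^^ N\<close> is known to vanish on \<open>span B\<close>; the extra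
    factor is applied first and brings an arbitrary vector there.\<close>
  ultimately have "\<forall>v. (X ^^ Suc N) v = 0" by (simp add: funpow_Suc_right del: funpow.simps)
  then show ?thesis by blast
qed

theorem perfect_ideal_trivial:
  assumes P: "subspace P" "\<And>x a b. x \<in> P \<Longrightarrow> br x a b \<in> P"
    and perfect: "P \<subseteq> span {br t a b | t a b. a \<in> P \<and> b \<in> P}"
    and orth: "\<And>x y. x \<in> P \<Longrightarrow> right_trace x y + right_trace y x = 0"
  shows "P \<subseteq> {0}"
proof -
  define h where "h = fn.span {br a b | a b. a \<in> P}"
  have h_inner: "h \<subseteq> inner" unfolding h_def inner_def by (rule fn.span_mono) blast
  have h_der: "derivation X" if "X \<in> h" for X using that h_inner inner_derivation by blast
  obtain C where C: "finite C" "fn.independent C" "fn.span C = inner" by (rule inner_basis)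
  have hP: "X v \<in> P" if "X \<in> h" for X v
    using that unfolding h_def
  proof (induction rule: fn.span_induct_alt)
    case base
    show ?case using subspace_0[OF P(1)] by simp
  next
    case (step c x y)
    then have "x v \<in> P" using P(2) by auto
    then show ?case using step.IH P(1) by (simp add: subspace_add subspace_scale)
  qed
  \<comment> \<open>\<open>E\<close> ranges over all derivations, since the one built in
    \<open>derivation_nilpotent\<close> need not lie in \<open>inner\<close>.\<close>
  have killing: "trace B (X \<circ> E) + fn.trace C (commutator X \<circ> commutator E) = 0"
    if "X \<in> h" and E: "derivation E" for X E
    using that(1)
  proof -
    interpret C: Vector_Spaces.linear "\<lambda>c (f :: 'v \<Rightarrow> 'v) x. scale c (f x)"
        "\<lambda>c (f :: 'v \<Rightarrow> 'v) x. scale c (f x)" "commutator E"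
      using E by (intro linear_commutator linear_derivation)
    have in_B: "X v \<in> span B" if "X \<in> h" for X v using h_der[OF that] by (simp add: derivation_def)
    have in_C: "commutator X (commutator E Z) \<in> fn.span C" if "X \<in> h" "Z \<in> C" for X Z
      using that(2) C(3) fn.span_base[of Z C]
      by (auto intro!: commutator_inner E h_der that(1))
    have zero_h: "0 \<in> h" unfolding h_def by (rule fn.span_zero)
    have "X \<in> fn.span {br a b | a b. a \<in> P}" using that(1) by (simp only: h_def)
    \<comment> \<open>Membership in \<open>h\<close> is carried along because additivity of the
      traces needs operators that map into the spans of \<open>B\<close> and
      \<open>C\<close>.\<close>
    then have "X \<in> h \<and> trace B (X \<circ> E) + fn.trace C (commutator X \<circ> commutator E) = 0"
    proof (induction rule: fn.span_induct_alt)
      case base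
      have "representation B 0 b = 0" "fn.representation C 0 Z = 0" for b Z
        by (simp_all add: representation_zero fn.representation_zero)
      moreover have "commutator (\<lambda>_. 0) Z = 0" if "Z \<in> inner" for Z
      proof -
        interpret Z: Vector_Spaces.linear scale scale Z
          using that by (intro linear_derivation inner_derivation)
        show ?thesis by (simp add: commutator_def fun_eq_iff)
      qed
      then have "commutator (\<lambda>_. 0) (commutator E Z) = 0" if "Z \<in> C" for Z
        using that C(3) fn.span_base[of Z C] commutator_inner[OF E] by blast
      ultimately have "trace B ((\<lambda>_. 0) \<circ> E) + fn.trace C (commutator (\<lambda>_. 0) \<circ> commutator E) = 0"
        by (simp add: trace_def fn.trace_def)
      with zero_h show ?case by (simp only: zero_fun_def)
    next
      case (step c X Y)
      then obtain a b where X: "X = br a b" and a: "a \<in> P" by blast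
      have Xh: "X \<in> h" using step(1) unfolding h_def by (rule fn.span_base)
      have Yh: "Y \<in> h" using step.IH by simp
      have "trace B (((\<lambda>x. scale c (X x)) + Y) \<circ> E)
          = trace B (\<lambda>v. scale c ((X \<circ> E) v) + (Y \<circ> E) v)"
        by (intro trace_cong) simp
      also have "\<dots> = trace B (\<lambda>v. scale c ((X \<circ> E) v)) + trace B (Y \<circ> E)"
        using indep_B in_B Xh Yh by (intro trace_add) (auto intro: span_scale)
      also have "trace B (\<lambda>v. scale c ((X \<circ> E) v)) = c * trace B (X \<circ> E)"
        using indep_B in_B Xh by (intro trace_scale) auto
      finally have 1: "trace B (((\<lambda>x. scale c (X x)) + Y) \<circ> E)
          = c * trace B (X \<circ> E) + trace B (Y \<circ> E)" .
      have "commutator ((\<lambda>x. scale c (X x)) + Y) (commutator E Z)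
          = (\<lambda>x. scale c (commutator X (commutator E Z) x)) + commutator Y (commutator E Z)"
        if "Z \<in> C" for Z
      proof -
        have "derivation (commutator E Z)"
          using that C(3) fn.span_base[of Z C] by (intro inner_derivation commutator_inner[OF E]) auto
        then interpret W: Vector_Spaces.linear scale scale "commutator E Z" by (rule linear_derivation)
        show ?thesis
          by (auto simp: commutator_def[of _ "commutator E Z"] fun_eq_iff W.add W.scale algebra_simps)
      qed
      then have "fn.trace C (commutator ((\<lambda>x. scale c (X x)) + Y) \<circ> commutator E)
          = fn.trace C (\<lambda>Z. (\<lambda>x. scale c ((commutator X \<circ> commutator E) Z x))
              + (commutator Y \<circ> commutator E) Z)"
        by (intro fn.trace_cong) simp
      also have "\<dots> = fn.trace C (\<lambda>Z x. scale c ((commutator X \<circ> commutator E) Z x))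
          + fn.trace C (commutator Y \<circ> commutator E)"
        using in_C[OF Xh] in_C[OF Yh] C(2)
        by (intro fn.trace_add) (auto intro: fn.span_scale)
      also have "fn.trace C (\<lambda>Z x. scale c ((commutator X \<circ> commutator E) Z x))
          = c * fn.trace C (commutator X \<circ> commutator E)"
        using in_C[OF Xh] C(2) by (intro fn.trace_scale) auto
      finally have 2: "fn.trace C (commutator ((\<lambda>x. scale c (X x)) + Y) \<circ> commutator E)
          = c * fn.trace C (commutator X \<circ> commutator E) + fn.trace C (commutator Y \<circ> commutator E)" .
      have 3: "trace B (X \<circ> E) + fn.trace C (commutator X \<circ> commutator E) = 0"
        unfolding X killing_br[OF C E] orth[OF a] by simp
      have "c * trace B (X \<circ> E) + trace B (Y \<circ> E) + (c * fn.trace C (commutator X \<circ> commutator E)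
            + fn.trace C (commutator Y \<circ> commutator E))
          = c * (trace B (X \<circ> E) + fn.trace C (commutator X \<circ> commutator E))
            + (trace B (Y \<circ> E) + fn.trace C (commutator Y \<circ> commutator E))"
        by (simp add: algebra_simps)
      then have "trace B (((\<lambda>x. scale c (X x)) + Y) \<circ> E)
          + fn.trace C (commutator ((\<lambda>x. scale c (X x)) + Y) \<circ> commutator E) = 0"
        unfolding 1 2 by (simp only: 3 conjunct2[OF step.IH]) simp
      moreover have "(\<lambda>x. scale c (X x)) + Y \<in> h"
        using Xh Yh unfolding h_def by (intro fn.span_add fn.span_scale)
      ultimately show ?case by blast
    qed
    then show ?thesis by blast
  qed
  have "\<exists>n. lower_series h n = {0}"
  proof (rule Engel)
    show "module.subspace (\<lambda>c f x. scale c (f x)) h" unfolding h_def by (rule fn.subspace_span)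
    show "finite C" by fact
    show "h \<subseteq> module.span (\<lambda>c f x. scale c (f x)) C" using h_inner C(3) by simp
    show "Vector_Spaces.linear scale scale X" if "X \<in> h" for X
      using h_der[OF that] by (rule linear_derivation)
    show "\<exists>n. \<forall>v. (X ^^ n) v = 0" if "X \<in> h" for X
      using that h_inner by (intro derivation_nilpotent[OF h_der _ C killing]) auto
    show "commutator X Y \<in> h" if X: "X \<in> h" and "Y \<in> h" for X Y
      using that(2) unfolding h_def
    proof (induction rule: fn.span_induct_alt)
      case base
      interpret X: Vector_Spaces.linear scale scale X using X h_der linear_derivation by blast
      have "commutator X 0 = 0" by (simp add: commutator_def fun_eq_iff)
      then show ?case by (simp only: fn.span_zero)
    next
      case (step c x y)
      interpret C: Vector_Spaces.linear "\<lambda>c (f :: 'v \<Rightarrow> 'v) x. scale c (f x)"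
          "\<lambda>c (f :: 'v \<Rightarrow> 'v) x. scale c (f x)" "commutator X"
        using X by (intro linear_commutator linear_derivation h_der)
      obtain a b where x: "x = br a b" and a: "a \<in> P" using step(1) by blast
      have "br (X a) b \<in> {br a b | a b. a \<in> P}" "br a (X b) \<in> {br a b | a b. a \<in> P}"
        using hP[OF X] a by blast+
      then have "commutator X x \<in> fn.span {br a b | a b. a \<in> P}"
        unfolding x commutator_br[OF h_der[OF X]] by (intro fn.span_add fn.span_base)
      then show ?case
        using step.IH unfolding C.add C.scale by (intro fn.span_add fn.span_scale)
    qed
  qed
  then obtain n where n: "lower_series h n = {0}" by blast
  have "P \<subseteq> lower_series h m" for m
  proof (induction m)
    case 0
    show ?case by simp
  next
    case (Suc m)
    \<comment> \<open>Perfectness provides elements of \<open>P\<close> in the last two places.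
      Exchanging the first two arguments produces \<open>br a t\<close>, which belongs to
      \<open>h\<close>, applied to an element of \<open>P\<close>.\<close>
    have "br t a b \<in> lower_series h (Suc m)" if "a \<in> P" "b \<in> P" for t a b
    proof -
      have "br a t \<in> h" unfolding h_def using that by (intro fn.span_base) blast
      then have "br a t b \<in> lower_series h (Suc m)" using Suc that by (intro lower_series_step) auto
      then show ?thesis
        unfolding br_swap[of t a b] by (intro subspace_neg subspace_lower_series)
    qed
    then have "span {br t a b | t a b. a \<in> P \<and> b \<in> P} \<subseteq> lower_series h (Suc m)"
      by (intro span_minimal subspace_lower_series) blast
    with perfect show ?case by blast
  qed
  from this[of n] show ?thesis using n by simp
qed

end

subsection \<open>Finite dimensional subspaces\<close>

context vector_space
begin

lemma independent_card_le_dim_subspace: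
  assumes "finite B" "W \<subseteq> span B" "independent C" "C \<subseteq> W"
  shows "finite C \<and> card C \<le> dim W"
proof -
  obtain D where D: "D \<subseteq> W" "independent D" "W \<subseteq> span D" "card D = dim W"
    using basis_exists by blast
  have "finite D" using independent_span_bound[OF assms(1) D(2)] D(1) assms(2) by auto
  then show ?thesis
    using independent_span_bound[of D C] assms(3,4) D by auto
qed

lemma dim_less:
  assumes "finite B" "W \<subseteq> span B" "subspace U" "U \<subset> W"
  shows "dim U < dim W"
proof -
  obtain C where C: "C \<subseteq> U" "independent C" "U \<subseteq> span C" "card C = dim U"
    using basis_exists by blast
  obtain x where x: "x \<in> W" "x \<notin> U" using assms(4) by blast
  have "span C \<subseteq> U" using C(1) assms(3) by (rule span_minimal)
  then have "independent (insert x C)" using x(2) C(2) by (intro independent_insertI) auto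
  moreover have "insert x C \<subseteq> W" using x C(1) assms(4) by auto
  ultimately have "finite (insert x C) \<and> card (insert x C) \<le> dim W"
    by (rule independent_card_le_dim_subspace[OF assms(1,2)])
  moreover have "x \<notin> C" using x(2) C(1) by auto
  ultimately show ?thesis using C(4) by (auto simp: card_insert_if)
qed

lemma decreasing_subspaces_stationary:
  assumes "finite B" "\<And>n. A n \<subseteq> span B" "\<And>n. subspace (A n)" "\<And>n. A (Suc n) \<subseteq> A n"
  shows "\<exists>n. A (Suc n) = A n"
proof -
  obtain n where "\<And>m. dim (A n) \<le> dim (A m)"
    using ex_has_least_nat[of "\<lambda>_. True" _ "\<lambda>n. dim (A n)"] by auto
  then have "\<not> A (Suc n) \<subset> A n"
    using dim_less[OF assms(1,2,3), of "Suc n" n] by (meson not_le)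
  then show ?thesis using assms(4) by blast
qed

lemma projection_exists:
  assumes "independent B"
  obtains p where "Vector_Spaces.linear scale scale p" "\<And>x. p x \<in> span B"
    "\<And>x. x \<in> span B \<Longrightarrow> p x = x"
proof -
  interpret vector_space_pair scale scale ..
  define p where "p = construct B (\<lambda>b. b)"
  have p: "Vector_Spaces.linear scale scale p"
    unfolding p_def by (rule linear_construct) fact
  have "p x = x" if "x \<in> span B" for x
    by (rule linear_eq_on[where f = p and g = "\<lambda>x. x", OF p _ that])
      (auto simp: p_def construct_basis[OF assms] intro: linearI)
  moreover have "p x \<in> span B" for x
    using construct_in_span[OF assms, of "\<lambda>b. b" x] by (simp add: p_def)
  ultimately show thesis using that p by blast
qed

text \<open>A bracket is linear on its carrier only, whereas \<open>trace_commute\<close> asks for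
  maps linear on the ambient space. Composing with a projection onto \<open>span B\<close> repairs
  this without changing the traces.\<close>

lemma trace_commute_on:
  assumes B: "finite B" "independent B"
    and f: "\<And>x y. x \<in> span B \<Longrightarrow> y \<in> span B \<Longrightarrow> f (x + y) = f x + f y"
      "\<And>c x. x \<in> span B \<Longrightarrow> f (scale c x) = scale c (f x)" "f ` span B \<subseteq> span B"
    and g: "\<And>x y. x \<in> span B \<Longrightarrow> y \<in> span B \<Longrightarrow> g (x + y) = g x + g y"
      "\<And>c x. x \<in> span B \<Longrightarrow> g (scale c x) = scale c (g x)" "g ` span B \<subseteq> span B"
  shows "trace B (\<lambda>x. f (g x)) = trace B (\<lambda>x. g (f x))"
proof -
  interpret vector_space_pair scale scale ..
  obtain p where p: "Vector_Spaces.linear scale scale p" "\<And>x. p x \<in> span B"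
    "\<And>x. x \<in> span B \<Longrightarrow> p x = x"
    using projection_exists[OF B(2)] by blast
  interpret p: Vector_Spaces.linear scale scale p by (rule p(1))
  have "trace B ((f \<circ> p) \<circ> (g \<circ> p)) = trace B ((g \<circ> p) \<circ> (f \<circ> p))"
    using B f(3) g(3) p(2)
    by (intro trace_commute linearI) (auto simp: p.add p.scale f(1,2) g(1,2) image_subset_iff)
  also have "trace B ((f \<circ> p) \<circ> (g \<circ> p)) = trace B (\<lambda>x. f (g x))"
    using g(3) p(3) by (intro trace_cong) (simp add: image_subset_iff span_base)
  also have "trace B ((g \<circ> p) \<circ> (f \<circ> p)) = trace B (\<lambda>x. g (f x))"
    using f(3) p(3) by (intro trace_cong) (simp add: image_subset_iff span_base)
  finally show ?thesis .
qed

text \<open>The map that sends \<open>x\<close> to the vector with coordinates \<open>k x b\<close>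
  is injective on \<open>span B\<close> by nondegeneracy, hence onto by counting dimensions.\<close>

lemma nondegenerate_form_represents:
  assumes B: "finite B" "independent B"
    and k: "\<And>x y b. x \<in> span B \<Longrightarrow> y \<in> span B \<Longrightarrow> b \<in> B \<Longrightarrow> k (x + y) b = k x b + k y b"
      "\<And>c x b. x \<in> span B \<Longrightarrow> b \<in> B \<Longrightarrow> k (scale c x) b = c * k x b"
    and nondegenerate: "\<And>x. x \<in> span B \<Longrightarrow> (\<And>b. b \<in> B \<Longrightarrow> k x b = 0) \<Longrightarrow> x = 0"
  shows "\<exists>t\<in>span B. \<forall>b\<in>B. k t b = c b"
proof -
  interpret vector_space_pair scale scale ..
  obtain p where p: "Vector_Spaces.linear scale scale p" "\<And>x. p x \<in> span B"
    "\<And>x. x \<in> span B \<Longrightarrow> p x = x"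
    using projection_exists[OF B(2)] by blast
  interpret p: Vector_Spaces.linear scale scale p by (rule p(1))
  define h where "h = (\<lambda>x. \<Sum>b\<in>B. scale (k (p x) b) b)"
  have h: "Vector_Spaces.linear scale scale h"
    by (rule linearI)
      (simp_all add: h_def p.add p.scale p(2) k scale_left_distrib sum.distrib scale_sum_right)
  interpret h: Vector_Spaces.linear scale scale h by (rule h)
  have coeff: "k x b = k' b" if "h x = (\<Sum>b\<in>B. scale (k' b) b)" "x \<in> span B" "b \<in> B" for x k' b
  proof -
    have "(\<Sum>b\<in>B. scale (k x b - k' b) b) = 0"
      using that(1,2) by (simp add: h_def p(3) scale_left_diff_distrib sum_subtractf)
    then show ?thesis using independentD[OF B(2) B(1) subset_refl _ that(3)] by fastforce
  qed
  have hB: "h x \<in> span B" for x unfolding h_def by (intro span_sum span_scale span_base)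
  have "inj_on h (span B)"
  proof (rule inj_onI)
    fix x y assume xy: "x \<in> span B" "y \<in> span B" "h x = h y"
    then have "h (x - y) = (\<Sum>b\<in>B. scale 0 b)" by (simp add: h.diff)
    then have "k (x - y) b = 0" if "b \<in> B" for b
      using coeff[of "x - y" "\<lambda>_. 0" b] that xy by (auto intro: span_diff)
    then have "x - y = 0" using xy by (intro nondegenerate span_diff)
    then show "x = y" by simp
  qed
  then have ind: "independent (h ` B)" and card: "card (h ` B) = card B"
    using h.independent_injective_image[OF B(2)] span_superset[of B]
    by (auto intro!: card_image elim: inj_on_subset)
  have "span B \<subseteq> span (h ` B)"
  proof (rule ccontr)
    assume "\<not> ?thesis"
    then obtain x where x: "x \<in> span B" "x \<notin> span (h ` B)" by blast
    then have "independent (insert x (h ` B))" using ind by (intro independent_insertI)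
    moreover have "insert x (h ` B) \<subseteq> span B" using x hB by auto
    ultimately have "card (insert x (h ` B)) \<le> card B"
      using independent_span_bound[OF B(1)] by blast
    moreover have "x \<notin> h ` B" using x span_base by blast
    ultimately show False using card B(1) by simp
  qed
  moreover have "(\<Sum>b\<in>B. scale (c b) b) \<in> span B" by (intro span_sum span_scale span_base)
  ultimately have "(\<Sum>b\<in>B. scale (c b) b) \<in> h ` span B" by (auto simp: h.span_image)
  then obtain t where t: "t \<in> span B" "h t = (\<Sum>b\<in>B. scale (c b) b)" by auto
  then show ?thesis using coeff[of t c] by blast
qed

lemma separating_functional:
  assumes "subspace I" "v \<notin> I"
  obtains f where "Vector_Spaces.linear scale (*) f" "\<And>x. x \<in> I \<Longrightarrow> f x = 0" "f v = 1"
proof -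
  interpret R: vector_space "(*) :: 'a \<Rightarrow> 'a \<Rightarrow> 'a"
    by unfold_locales (auto simp: algebra_simps)
  interpret vector_space_pair scale "(*) :: 'a \<Rightarrow> 'a \<Rightarrow> 'a" ..
  obtain C where C: "C \<subseteq> I" "independent C" "I \<subseteq> span C"
    using maximal_independent_subset[of I] by blast
  have "span C \<subseteq> I" using C(1) assms(1) by (rule span_minimal)
  then have "independent (insert v C)" using assms(2) C(2) by (intro independent_insertI) auto
  from linear_independent_extend[OF this, of "\<lambda>x. if x = v then 1 else 0"]
  obtain f where f: "Vector_Spaces.linear scale (*) f"
    "\<And>x. x \<in> insert v C \<Longrightarrow> f x = (if x = v then 1 else 0)" by blast
  interpret f: Vector_Spaces.linear scale "(*)" f by (rule f(1))
  have fC: "f x = 0" if "x \<in> C" for x using f(2)[of x] that C(1) assms(2) by auto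
  have "f x = 0" if "x \<in> span C" for x
    using that by (induction rule: span_induct_alt) (simp_all add: f.add f.scale fC)
  moreover have "f v = 1" using f(2)[of v] by simp
  ultimately show thesis using that f(1) C(3) by blast
qed

end

subsection \<open>Ideals and the solvable radical\<close>

context lie_triple_system
begin

lemma bracket_subset:
  assumes "subspace I" "\<And>a b c. a \<in> A \<Longrightarrow> b \<in> B \<Longrightarrow> c \<in> C \<Longrightarrow> br a b c \<in> I"
  shows "bracket A B C \<subseteq> I"
  unfolding bracket_def using assms by (intro span_minimal) blast

lemma bracketI: "a \<in> A \<Longrightarrow> b \<in> B \<Longrightarrow> c \<in> C \<Longrightarrow> br a b c \<in> bracket A B C"
  unfolding bracket_def by (rule span_base) blast

lemma bracket_mono: "A \<subseteq> A' \<Longrightarrow> B \<subseteq> B' \<Longrightarrow> C \<subseteq> C' \<Longrightarrow> bracket A B C \<subseteq> bracket A' B' C'"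
  unfolding bracket_def by (rule span_mono) blast

lemma subspace_bracket: "subspace (bracket A B C)"
  by (simp add: bracket_def)

lemma lts_idealI:
  assumes "subspace I" "I \<subseteq> carr" "\<And>x a b. x \<in> I \<Longrightarrow> a \<in> carr \<Longrightarrow> b \<in> carr \<Longrightarrow> br x a b \<in> I"
  shows "lts_ideal I"
  using assms by (simp add: lts_ideal_def bracket_subset)

lemma lts_idealD:
  assumes "lts_ideal I"
  shows "subspace I" "I \<subseteq> carr"
    and "x \<in> I \<Longrightarrow> a \<in> carr \<Longrightarrow> b \<in> carr \<Longrightarrow> br x a b \<in> I"
    and "x \<in> I \<Longrightarrow> a \<in> carr \<Longrightarrow> b \<in> carr \<Longrightarrow> br a x b \<in> I"
    and "x \<in> I \<Longrightarrow> a \<in> carr \<Longrightarrow> b \<in> carr \<Longrightarrow> br a b x \<in> I"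
proof -
  show I: "subspace I" "I \<subseteq> carr" using assms by (auto simp: lts_ideal_def)
  show 1: "br x a b \<in> I" if "x \<in> I" "a \<in> carr" "b \<in> carr" for x a b
    using assms bracketI[of x I a carr b carr] that by (auto simp: lts_ideal_def)
  show "br a x b \<in> I" if "x \<in> I" "a \<in> carr" "b \<in> carr" for x a b
  proof -
    have "br a x b = - br x a b" using that I(2) by (intro bracket_swap) auto
    then show ?thesis using subspace_neg[OF I(1) 1[OF that]] by simp
  qed
  show "br a b x \<in> I" if "x \<in> I" "a \<in> carr" "b \<in> carr" for x a b
  proof -
    have "br a b x = br x b a - br x a b" using that I(2) by (intro bracket_rotate) auto
    then show ?thesis
      using subspace_diff[OF I(1) 1[OF that(1,3,2)] 1[OF that]] by simp
  qed
qed

text \<open>By the cyclic identity the bracket ideal also contains all brackets whose first two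
  entries lie in \<open>I\<close>. The derivation identity for \<open>[t,a,-]\<close> applied to
  \<open>[b,y,z]\<close> then expresses \<open>[[t,a,b],y,z]\<close> by brackets with two entries in
  \<open>I\<close>.\<close>

lemma derived_ideal_step:
  assumes I: "lts_ideal I"
  shows "lts_ideal (bracket carr I I)" "bracket carr I I \<subseteq> I"
proof -
  note ID = lts_idealD[OF I]
  let ?J = "bracket carr I I"
  show JI: "?J \<subseteq> I" using ID by (intro bracket_subset) auto
  then have Jc: "?J \<subseteq> carr" using ID(2) by blast
  have IIc: "br a b t \<in> ?J" if "a \<in> I" "b \<in> I" "t \<in> carr" for a b t
  proof -
    have "br a b t = br t b a - br t a b" using that ID(2) by (intro bracket_rotate) auto
    then show ?thesis using that by (auto intro!: subspace_diff subspace_bracket bracketI)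
  qed
  have gen: "br (br t a b) y z \<in> ?J"
    if "t \<in> carr" "a \<in> I" "b \<in> I" "y \<in> carr" "z \<in> carr" for t a b y z
  proof -
    have c: "a \<in> carr" "b \<in> carr" using that ID(2) by auto
    have "br t a (br b y z) = br (br t a b) y z + br b (br t a y) z + br b y (br t a z)"
      using that c by (intro br_derivation)
    moreover have "br b y (br t a z) = - br y b (br t a z)"
      using that c by (intro bracket_swap) (auto intro: br_closed)
    ultimately have "br (br t a b) y z = br t a (br b y z) - br b (br t a y) z + br y b (br t a z)"
      by (simp add: algebra_simps)
    moreover have "br t a (br b y z) \<in> ?J" using that ID(3) by (intro bracketI) auto
    moreover have "br b (br t a y) z \<in> ?J" using that ID(4) by (intro IIc) auto
    moreover have "br y b (br t a z) \<in> ?J" using that ID(4) by (intro bracketI) auto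
    ultimately show ?thesis by (simp only: subspace_add subspace_diff subspace_bracket)
  qed
  show "lts_ideal ?J"
  proof (rule lts_idealI[OF subspace_bracket Jc])
    fix x y z assume x: "x \<in> ?J" and yz: "y \<in> carr" "z \<in> carr"
    \<comment> \<open>Membership in \<open>carr\<close> is part of the induction because linearity
      of the bracket is available only there.\<close>
    from x have "x \<in> carr \<and> br x y z \<in> ?J"
      unfolding bracket_def[of carr I I]
    proof (induction rule: span_induct_alt)
      case base
      show ?case using yz by (simp add: carr_closed bracket_zero span_zero)
    next
      case (step c x x')
      then obtain t a b where t: "x = br t a b" "t \<in> carr" "a \<in> I" "b \<in> I" by blast
      have xc: "x \<in> carr" using t ID(2) by (auto intro: br_closed)
      have "br x y z \<in> ?J" using gen t yz by simp
      moreover have "br (scale c x + x') y z = scale c (br x y z) + br x' y z"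
        using xc step.IH yz by (simp add: br_add1 br_scale1 carr_closed)
      ultimately show ?case
        using xc step.IH by (auto simp: carr_closed bracket_def intro!: span_add span_scale)
    qed
    then show "br x y z \<in> ?J" by simp
  qed
qed

lemma derived_ideal: "lts_ideal I \<Longrightarrow> lts_ideal (derived I n)"
  by (induction n) (auto intro: derived_ideal_step)

lemma derived_Suc_subset: "lts_ideal I \<Longrightarrow> derived I (Suc n) \<subseteq> derived I n"
  using derived_ideal_step(2)[OF derived_ideal] by simp

lemma derived_mono: "I \<subseteq> J \<Longrightarrow> derived I n \<subseteq> derived J n"
  by (induction n) (auto intro: bracket_mono[THEN subsetD])

lemma derived_add: "derived I (n + m) = derived (derived I m) n"
  by (induction n) auto

lemma lts_ideal_sum:
  assumes I: "lts_ideal I" and J: "lts_ideal J"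
  shows "lts_ideal (I + J)"
proof (rule lts_idealI)
  have "I + J = {x + y | x y. x \<in> I \<and> y \<in> J}" by (auto simp: set_plus_def)
  then show "subspace (I + J)"
    using subspace_sums[OF lts_idealD(1)[OF I] lts_idealD(1)[OF J]] by simp
  show "I + J \<subseteq> carr"
    using lts_idealD(2)[OF I] lts_idealD(2)[OF J] by (auto simp: set_plus_def intro!: carr_closed)
  fix x a b assume "x \<in> I + J" and ab: "a \<in> carr" "b \<in> carr"
  then obtain i j where x: "x = i + j" "i \<in> I" "j \<in> J" by (auto simp: set_plus_def)
  then have "br x a b = br i a b + br j a b"
    using ab lts_idealD(2)[OF I] lts_idealD(2)[OF J] by (auto intro: br_add1)
  then show "br x a b \<in> I + J"
    using x ab lts_idealD(3)[OF I] lts_idealD(3)[OF J] by (auto intro: set_plus_intro)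
qed

text \<open>Modulo \<open>J\<close> the derived series of \<open>I + J\<close> is that of
  \<open>I\<close>, since every mixed bracket falls into \<open>J\<close>. Once the series of
  \<open>I\<close> has reached 0, the solvability of \<open>J\<close> takes over.\<close>

lemma derived_sum_subset:
  assumes I: "lts_ideal I" and J: "lts_ideal J"
  shows "derived (I + J) n \<subseteq> derived I n + J"
proof (induction n)
  case 0
  show ?case by simp
next
  case (Suc n)
  note IDn = lts_idealD[OF derived_ideal[OF I, of n]]
  note JD = lts_idealD[OF J]
  have sub: "subspace (derived I (Suc n) + J)"
    by (intro lts_idealD(1) lts_ideal_sum derived_ideal I J)
  have "br t x y \<in> derived I (Suc n) + J"
    if t: "t \<in> carr" and "x \<in> derived I n + J" "y \<in> derived I n + J" for t x y
  proof -
    obtain a j b k where x: "x = a + j" "a \<in> derived I n" "j \<in> J"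
      and y: "y = b + k" "b \<in> derived I n" "k \<in> J"
      using \<open>x \<in> _\<close> \<open>y \<in> _\<close> by (auto simp: set_plus_def)
    have c: "a \<in> carr" "b \<in> carr" "j \<in> carr" "k \<in> carr" using x y IDn(2) JD(2) by auto
    have "br t x y = br t a b + (br t a k + (br t j b + br t j k))"
      using t c unfolding x(1) y(1) by (simp add: br_add2 br_add3 carr_closed add_ac)
    moreover have "br t a b \<in> derived I (Suc n)" using t x y by (simp add: bracketI)
    moreover have "br t a k + (br t j b + br t j k) \<in> J"
      using t c x y JD by (intro subspace_add) auto
    ultimately show ?thesis by (auto simp: set_plus_def simp del: derived.simps)
  qed
  then have "bracket carr (derived I n + J) (derived I n + J) \<subseteq> derived I (Suc n) + J"
    by (intro bracket_subset sub)
  moreover have "derived (I + J) (Suc n) \<subseteq> bracket carr (derived I n + J) (derived I n + J)"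
    using Suc by (simp add: bracket_mono)
  ultimately show ?case by blast
qed

lemma solvable_ideal_sum:
  assumes "solvable_ideal I" "solvable_ideal J"
  shows "solvable_ideal (I + J)"
proof -
  obtain k m where I: "lts_ideal I" "derived I k = {0}" and J: "lts_ideal J" "derived J m = {0}"
    using assms by (auto simp: solvable_ideal_def)
  have "derived (I + J) k \<subseteq> J"
    using derived_sum_subset[OF I(1) J(1), of k] I(2) by (auto simp: set_plus_def)
  then have "derived (I + J) (m + k) \<subseteq> {0}"
    unfolding derived_add J(2)[symmetric] by (rule derived_mono)
  moreover have "0 \<in> derived (I + J) (m + k)"
    by (intro subspace_0 lts_idealD(1) derived_ideal lts_ideal_sum I J)
  ultimately show ?thesis
    using lts_ideal_sum[OF I(1) J(1)] by (auto simp: solvable_ideal_def)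
qed

text \<open>\<open>GREATEST\<close> is meaningful only if a greatest solvable ideal exists. A
  solvable ideal containing an independent set of largest possible size is one, because its sum with
  any other solvable ideal is solvable again.\<close>

lemma solvable_ideal_subset_radical:
  assumes B: "finite B" "span B = carr" and K: "solvable_ideal K"
  shows "K \<subseteq> solvable_radical"
proof -
  define good where "good = (\<lambda>(I, C). solvable_ideal I \<and> independent C \<and> C \<subseteq> I)"
  have bound: "finite C \<and> card C \<le> card B" if "good (I, C)" for I C
    using that independent_span_bound[OF B(1)] B(2) lts_idealD(2)[of I]
    by (auto simp: good_def solvable_ideal_def)
  have "good (K, {})" using K by (simp add: good_def independent_empty)
  moreover have "\<forall>p. good p \<longrightarrow> card (snd p) < Suc (card B)"
    using bound by (auto simp: less_Suc_eq_le)
  ultimately have "\<exists>p. good p \<and> (\<forall>q. good q \<longrightarrow> card (snd q) \<le> card (snd p))"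
    by (rule Lattices_Big.ex_has_greatest_nat)
  then obtain I C where good: "good (I, C)" and max: "\<And>q. good q \<Longrightarrow> card (snd q) \<le> card C"
    by auto
  then have I: "solvable_ideal I" "lts_ideal I" and C: "independent C" "C \<subseteq> I"
    by (auto simp: good_def solvable_ideal_def)
  have greatest: "J \<subseteq> I" if J: "solvable_ideal J" for J
  proof (rule ccontr)
    assume "\<not> J \<subseteq> I"
    then obtain x where x: "x \<in> J" "x \<notin> I" by blast
    have J': "lts_ideal J" using J by (simp add: solvable_ideal_def)
    have "span C \<subseteq> I" using C(2) lts_idealD(1)[OF I(2)] by (rule span_minimal)
    then have "independent (insert x C)" using x(2) C(1) by (intro independent_insertI) auto
    moreover have "y \<in> I + J" if "y \<in> I" for y
      using that subspace_0[OF lts_idealD(1)[OF J']] by (force simp: set_plus_def)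
    then have "insert x C \<subseteq> I + J"
      using x C(2) subspace_0[OF lts_idealD(1)[OF I(2)]] by (force simp: set_plus_def)
    ultimately have "good (I + J, insert x C)"
      using solvable_ideal_sum[OF I(1) J] by (simp add: good_def)
    from max[OF this] have "card (insert x C) \<le> card C" by simp
    moreover have "x \<notin> C" using x(2) C(2) by blast
    ultimately show False using bound[OF good] by simp
  qed
  have "solvable_radical = I"
    unfolding solvable_radical_def by (rule Greatest_equality) (use I greatest in auto)
  then show ?thesis using greatest[OF K] by simp
qed

end

subsection \<open>The Killing form\<close>

text \<open>Used twice: with \<open>S\<close> equal to \<open>span B\<close>, for the semisimple
  system itself, and with \<open>S\<close> the system of quotients. The traces are over
  \<open>B\<close> in both cases, so the two forms agree on \<open>span B\<close>.\<close>

locale lts_over = lie_triple_system scale S br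
  for scale :: "'k::field_char_0 \<Rightarrow> 'v::ab_group_add \<Rightarrow> 'v" and S br +
  fixes B :: "'v set"
  assumes finite_B: "finite B" and indep_B: "independent B" and span_subset: "span B \<subseteq> S"
    and br_span: "\<lbrakk>x \<in> span B; y \<in> span B; z \<in> span B\<rbrakk> \<Longrightarrow> br x y z \<in> span B"
begin

definition acts :: "'v \<Rightarrow> bool" where
  "acts s \<longleftrightarrow> s \<in> S \<and> (\<forall>x\<in>span B. \<forall>y\<in>span B.
    br s x y \<in> span B \<and> br x s y \<in> span B \<and> br x y s \<in> span B)"

definition killing_form :: "'v \<Rightarrow> 'v \<Rightarrow> 'k" where
  "killing_form u v = trace B (\<lambda>z. br z u v + br z v u)"

text \<open>With one argument in \<open>span B\<close> and the other acting, the maps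
  \<open>[-,u,v]\<close>, \<open>[-,v,u]\<close> and \<open>[u,v,-]\<close> preserve
  \<open>span B\<close>, and traces over \<open>B\<close> behave as usual.\<close>

definition acting_pair :: "'v \<Rightarrow> 'v \<Rightarrow> bool" where
  "acting_pair u v \<longleftrightarrow> acts u \<and> v \<in> span B \<or> u \<in> span B \<and> acts v"

lemma in_carr: "x \<in> span B \<Longrightarrow> x \<in> S"
  using span_subset by blast

lemma acts_carr: "acts s \<Longrightarrow> s \<in> S"
  by (simp add: acts_def)

lemma acts_span: "x \<in> span B \<Longrightarrow> acts x"
  by (simp add: acts_def in_carr br_span)

lemma acts_br:
  assumes "acts s" "x \<in> span B" "y \<in> span B"
  shows "br s x y \<in> span B" "br x s y \<in> span B" "br x y s \<in> span B"
  using assms by (auto simp: acts_def)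

lemma acting_pair_carr: "acting_pair u v \<Longrightarrow> u \<in> S \<and> v \<in> S"
  by (auto simp: acting_pair_def acts_carr in_carr)

lemma acting_pair_br:
  assumes "acting_pair u v" "z \<in> span B"
  shows "br z u v \<in> span B" "br z v u \<in> span B" "br u v z \<in> span B"
  using assms by (auto simp: acting_pair_def acts_br)

lemma killing_form_sym: "killing_form u v = killing_form v u"
  by (simp add: killing_form_def add.commute)

lemma killing_form_add:
  assumes "acting_pair u v" "acting_pair u' v"
  shows "killing_form (u + u') v = killing_form u v + killing_form u' v"
proof -
  have "killing_form (u + u') v = trace B (\<lambda>z. (br z u v + br z v u) + (br z u' v + br z v u'))"
    unfolding killing_form_def
  proof (rule trace_cong)
    fix b assume "b \<in> B"
    then have "b \<in> S" using in_carr span_base by blast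
    then show "br b (u + u') v + br b v (u + u') = (br b u v + br b v u) + (br b u' v + br b v u')"
      using assms[THEN acting_pair_carr] by (simp add: br_add2 br_add3 algebra_simps)
  qed
  also have "\<dots> = killing_form u v + killing_form u' v"
    unfolding killing_form_def
    by (intro trace_add indep_B image_subsetI span_add acting_pair_br[OF assms(1)]
        acting_pair_br[OF assms(2)]) (erule span_base)+
  finally show ?thesis .
qed

lemma killing_form_scale:
  assumes "acting_pair u v"
  shows "killing_form (scale c u) v = c * killing_form u v"
proof -
  have "killing_form (scale c u) v = trace B (\<lambda>z. scale c (br z u v + br z v u))"
    unfolding killing_form_def
  proof (rule trace_cong)
    fix b assume "b \<in> B"
    then have "b \<in> S" using in_carr span_base by blast
    then show "br b (scale c u) v + br b v (scale c u) = scale c (br b u v + br b v u)"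
      using acting_pair_carr[OF assms] by (simp add: br_scale2 br_scale3 scale_right_distrib)
  qed
  also have "\<dots> = c * killing_form u v"
    unfolding killing_form_def
    by (intro trace_scale indep_B image_subsetI span_add acting_pair_br[OF assms]) (erule span_base)+
  finally show ?thesis .
qed

lemma killing_form_minus: "acting_pair u v \<Longrightarrow> killing_form (- u) v = - killing_form u v"
  using killing_form_scale[of u v "- 1"] by simp

text \<open>The commutator of \<open>[a,b,-]\<close> with the operator behind
  \<open>killing_form u v\<close> has trace 0. The four hypotheses ensure that all operators
  involved preserve \<open>span B\<close>.\<close>

lemma killing_form_derivation:
  assumes ab: "acting_pair a b" and uv: "acting_pair u v"
    and abu: "acting_pair (br a b u) v" and abv: "acting_pair u (br a b v)"
  shows "killing_form (br a b u) v + killing_form u (br a b v) = 0"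
proof -
  let ?d = "br a b" and ?r = "\<lambda>u v z. br z u v + br z v u"
  have S: "a \<in> S" "b \<in> S" "u \<in> S" "v \<in> S" using ab uv acting_pair_carr by auto
  note span = acting_pair_br[OF ab] acting_pair_br[OF uv] acting_pair_br[OF abu] acting_pair_br[OF abv]
  have "trace B (\<lambda>z. ?d (?r u v z)) = trace B (\<lambda>z. ?r u v (?d z))"
  proof (rule trace_commute_on[OF finite_B indep_B])
    show "?d ` span B \<subseteq> span B" by (intro image_subsetI span(3))
    show "?r u v ` span B \<subseteq> span B" by (intro image_subsetI span_add span(4,5))
  qed (use S in \<open>simp_all add: br_add1 br_add3 br_scale1 br_scale3 in_carr algebra_simps\<close>)
  also have "trace B (\<lambda>z. ?d (?r u v z))
      = trace B (\<lambda>z. ?r u v (?d z) + (?r (?d u) v z + ?r u (?d v) z))"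
  proof (rule trace_cong)
    fix z assume "z \<in> B"
    then have z: "z \<in> S" using in_carr span_base by blast
    have "?d (br z u v) = br (?d z) u v + br z (?d u) v + br z u (?d v)"
      "?d (br z v u) = br (?d z) v u + br z (?d v) u + br z v (?d u)"
      by (rule br_derivation[OF S(1,2) z S(3,4)], rule br_derivation[OF S(1,2) z S(4,3)])
    then show "?d (?r u v z) = ?r u v (?d z) + (?r (?d u) v z + ?r u (?d v) z)"
      using S z by (simp add: br_add3 br_closed algebra_simps)
  qed
  also have "\<dots> = trace B (\<lambda>z. ?r u v (?d z)) + trace B (\<lambda>z. ?r (?d u) v z + ?r u (?d v) z)"
    by (intro trace_add indep_B image_subsetI span_add span(4,5,7,8,10,11) span(3)) (erule span_base)+
  also have "trace B (\<lambda>z. ?r (?d u) v z + ?r u (?d v) z) = killing_form (?d u) v + killing_form u (?d v)"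
    
    unfolding killing_form_def
    by (intro trace_add indep_B image_subsetI span_add span(7,8,10,11)) (erule span_base)+
  finally show ?thesis by simp
qed

text \<open>At most one of the four arguments may leave \<open>span B\<close>, and that one has to
  act. The condition is invariant under permutations, so all symmetries below can be
  combined.\<close>

definition acting_quad :: "'v \<Rightarrow> 'v \<Rightarrow> 'v \<Rightarrow> 'v \<Rightarrow> bool" where
  "acting_quad a b c d \<longleftrightarrow>
    acting_pair a b \<and> c \<in> span B \<and> d \<in> span B \<or> a \<in> span B \<and> b \<in> span B \<and> acting_pair c d"

lemma acting_quad_br:
  assumes "acting_quad a b c d"
  shows "acting_pair (br a b c) d" "a \<in> S" "b \<in> S" "c \<in> S" "d \<in> S"
    "acting_pair a b" "acting_pair c d"
  using assms
  by (auto simp: acting_quad_def acting_pair_def acts_br acts_span br_span acts_carr in_carr)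

lemma killing_form_br_swap:
  assumes "acting_quad a b c d"
  shows "killing_form (br b a c) d = - killing_form (br a b c) d"
  using acting_quad_br[OF assms] bracket_swap[of a b c] by (simp add: killing_form_minus)

lemma killing_form_br_skew:
  assumes "acting_quad a b c d"
  shows "killing_form (br a b d) c = - killing_form (br a b c) d"
proof -
  have q: "acting_quad a b d c" using assms by (auto simp: acting_quad_def acting_pair_def)
  have "acting_pair c (br a b d)"
    using acting_quad_br(1)[OF q] by (auto simp: acting_pair_def)
  then have "killing_form (br a b c) d + killing_form c (br a b d) = 0"
    using acting_quad_br[OF assms] by (intro killing_form_derivation)
  then show ?thesis using killing_form_sym[of c "br a b d"] by (simp add: eq_neg_iff_add_eq_0 add.commute)
qed

lemma killing_form_br_cyclic:
  assumes "acting_quad a b c d"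
  shows "killing_form (br a b c) d + killing_form (br b c a) d + killing_form (br c a b) d = 0"
proof -
  have q: "acting_quad b c a d" "acting_quad c a b d"
    using assms by (auto simp: acting_quad_def acting_pair_def acts_span)
  note 1 = acting_quad_br[OF assms] and 2 = acting_quad_br[OF q(1)] and 3 = acting_quad_br[OF q(2)]
  have "br a b c + br b c a = - br c a b"
    using br_cyclic[of a b c] 1 by (simp add: eq_neg_iff_add_eq_0)
  then have "killing_form (br a b c) d + killing_form (br b c a) d = - killing_form (br c a b) d"
    using killing_form_add[OF 1(1) 2(1)] killing_form_minus[OF 3(1)] by simp
  then show ?thesis by simp
qed

text \<open>The form \<open>killing_form (br a b c) d\<close> has the symmetries of a curvature tensor, hence also the
  exchange symmetry of its two pairs of arguments.\<close>

lemma killing_form_br_exchange: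
  assumes "acting_quad s x y z"
  shows "killing_form (br s x y) z = killing_form (br y z s) x"
proof -
  have q: "acting_quad x y s z" "acting_quad x y z s" "acting_quad x z y s" "acting_quad y z s x"
    "acting_quad s z x y" "acting_quad z s x y" "acting_quad s y x z" "acting_quad s z y x"
    using assms by (auto simp: acting_quad_def acting_pair_def acts_span)
  \<comment> \<open>Four cyclic identities, one for each choice of the last argument, are combined
    by skewness in the first pair and in the last pair. Each side appears twice, and characteristic
    0 allows the halving.\<close>
  have "2 * killing_form (br s x y) z = 2 * killing_form (br y z s) x"
    using killing_form_br_cyclic[OF assms] killing_form_br_cyclic[OF q(2)] killing_form_br_cyclic[OF q(4)]
      killing_form_br_cyclic[OF q(6)] killing_form_br_skew[OF assms] killing_form_br_skew[OF q(1)] killing_form_br_skew[OF q(3)]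
      killing_form_br_skew[OF q(4)] killing_form_br_skew[OF q(5)] killing_form_br_skew[OF q(7)] killing_form_br_swap[OF q(3)]
      killing_form_br_swap[OF q(5)] killing_form_br_swap[OF q(7)] killing_form_br_swap[OF q(8)]
    by algebra
  then show ?thesis by simp
qed

text \<open>The adjoint of \<open>R(x,y)\<close> is \<open>R(y,x)\<close>. The exchange symmetry
  brings \<open>s\<close> to the last place of a bracket, from where skewness takes it out.\<close>

lemma killing_form_invariant:
  assumes "acts s" "x \<in> span B" "y \<in> span B" "z \<in> span B"
  shows "killing_form (br s x y) z = killing_form s (br z y x)"
proof -
  have q: "acting_quad s x y z" "acting_quad y z s x" "acting_quad y z x s"
    using assms by (auto simp: acting_quad_def acting_pair_def acts_span)
  have "killing_form (br s x y) z = killing_form (br y z s) x" using q(1) by (rule killing_form_br_exchange)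
  also have "\<dots> = - killing_form (br y z x) s" using q(3) by (rule killing_form_br_skew)
  also have "\<dots> = killing_form (br z y x) s" using killing_form_br_swap[OF q(3)] by simp
  finally show ?thesis by (simp add: killing_form_sym)
qed

end

section \<open>Nondegeneracy and orthogonal ideals\<close>

locale semisimple_lts = lie_triple_system scale T br
  for scale :: "'k::{alg_closed_field, field_char_0} \<Rightarrow> 'v::ab_group_add \<Rightarrow> 'v" and T br +
  fixes B :: "'v set"
  assumes finite_B: "finite B" and indep_B: "independent B" and span_B: "span B = T"
    and semisimple: "semisimple"
begin

sublocale lts_over scale T br B
  by unfold_locales (simp_all add: finite_B indep_B span_B br_closed)

lemma solvable_ideal_trivial: "solvable_ideal I \<Longrightarrow> I = {0}"
  using solvable_ideal_subset_radical[OF finite_B span_B, of I] semisimple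
    subspace_0[OF lts_idealD(1), of I]
  by (auto simp: semisimple_def solvable_ideal_def)

lemma acting_pair_T: "x \<in> T \<Longrightarrow> y \<in> T \<Longrightarrow> acting_pair x y"
  by (simp add: acting_pair_def acts_span span_B)

lemma lts_ideal_orthogonal:
  assumes I: "lts_ideal I"
  shows "lts_ideal {x \<in> T. \<forall>y\<in>I. killing_form x y = 0}"
proof -
  note ID = lts_idealD[OF I]
  have IT: "y \<in> I \<Longrightarrow> y \<in> T" for y using ID(2) by blast
  show ?thesis
  proof (rule lts_idealI)
    have "killing_form 0 y = 0" if "y \<in> I" for y
      using killing_form_scale[of 0 y 0] acting_pair_T[of 0 y] IT[OF that] by (simp add: carr_closed)
    then show "subspace {x \<in> T. \<forall>y\<in>I. killing_form x y = 0}"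
      by (intro subspaceI) (auto simp: carr_closed killing_form_add killing_form_scale acting_pair_T IT)
    fix x a b assume x: "x \<in> {x \<in> T. \<forall>y\<in>I. killing_form x y = 0}" and ab: "a \<in> T" "b \<in> T"
    have "killing_form (br x a b) y = 0" if y: "y \<in> I" for y
    proof -
      have "killing_form (br x a b) y = killing_form x (br y b a)"
        using x ab IT[OF y] by (intro killing_form_invariant acts_span) (auto simp: span_B)
      then show ?thesis using x y ab ID(3) by auto
    qed
    then show "br x a b \<in> {x \<in> T. \<forall>y\<in>I. killing_form x y = 0}" using x ab by (auto simp: br_closed)
  qed auto
qed

lemma derived_orthogonal_trivial:
  assumes N: "lts_ideal N" "\<And>x y. x \<in> N \<Longrightarrow> y \<in> T \<Longrightarrow> killing_form x y = 0"
  shows "\<exists>n. derived N n = {0}"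
proof -
  note ideal = derived_ideal[OF N(1)]
  have "\<exists>n. derived N (Suc n) = derived N n"
  proof (rule decreasing_subspaces_stationary[OF finite_B])
    show "derived N n \<subseteq> span B" for n unfolding span_B by (rule lts_idealD(2)[OF ideal])
  qed (rule lts_idealD(1)[OF ideal] derived_Suc_subset[OF N(1)])+
  then obtain n where n: "derived N (Suc n) = derived N n" by blast
  define P where "P = derived N n"
  have P: "lts_ideal P" unfolding P_def by (rule ideal)
  note PD = lts_idealD[OF P]
  have "P \<subseteq> N"
    unfolding P_def
  proof (induction n)
    case 0
    show ?case by simp
  next
    case (Suc n)
    then show ?case using derived_Suc_subset[OF N(1), of n] by blast
  qed
  obtain p where p: "Vector_Spaces.linear scale scale p" "\<And>x. p x \<in> T" "\<And>x. x \<in> T \<Longrightarrow> p x = x"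
    using projection_exists[OF indep_B] unfolding span_B by blast
  interpret p: Vector_Spaces.linear scale scale p by (rule p(1))
  \<comment> \<open>The extension by 0 along \<open>p\<close> makes the results on total operators
    applicable; on T the bracket is unchanged.\<close>
  define br' where "br' = (\<lambda>x y z. br (p x) (p y) (p z))"
  interpret E: extended_lts scale br' B p
  proof
    show "br' u v (br' x y z) = br' (br' u v x) y z + br' x (br' u v y) z + br' x y (br' u v z)"
      for u v x y z
      using br_derivation[of "p u" "p v" "p x" "p y" "p z"] p(2) by (simp add: br'_def p(3) br_closed)
    show "br' x y z + br' y z x + br' z x y = 0" for x y z
      using br_cyclic p(2) by (simp add: br'_def)
  qed (use p(2,3) br_closed in \<open>simp_all add: br'_def p.add p.scale br_add1 br_add2 br_add3
      br_scale1 br_scale2 br_scale3 br_alternating finite_B indep_B span_B p(1)\<close>)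
  have "P \<subseteq> {0}"
  proof (rule E.perfect_ideal_trivial[OF PD(1)])
    have pP: "p x = x" if "x \<in> P" for x using that PD(2) p(3) by blast
    show "br' x a b \<in> P" if "x \<in> P" for x a b
      using PD(3)[OF that p(2) p(2)] that by (simp add: br'_def pP)
    have "{br t a b | t a b. t \<in> T \<and> a \<in> P \<and> b \<in> P} \<subseteq> {br' t a b | t a b. a \<in> P \<and> b \<in> P}"
    proof clarify
      fix t a b assume "t \<in> T" "a \<in> P" "b \<in> P"
      then show "\<exists>t' a' b'. br t a b = br' t' a' b' \<and> a' \<in> P \<and> b' \<in> P"
        by (intro exI[of _ t] exI[of _ a] exI[of _ b]) (simp add: br'_def pP p(3))
    qed
    moreover have "P \<subseteq> span {br t a b | t a b. t \<in> T \<and> a \<in> P \<and> b \<in> P}"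
      using n by (simp add: P_def bracket_def)
    ultimately show "P \<subseteq> span {br' t a b | t a b. a \<in> P \<and> b \<in> P}"
      by (meson span_mono subset_trans)
    show "E.right_trace x y + E.right_trace y x = 0" if x: "x \<in> P" for x y
    proof -
      have "E.right_trace x y + E.right_trace y x = trace B (\<lambda>z. br' z x y + br' z y x)"
        unfolding E.right_trace_def
        by (rule trace_add[symmetric]) (auto simp: indep_B E.br_in_span)
      also have "\<dots> = killing_form x (p y)"
        unfolding killing_form_def using span_superset[of B] span_B x
        by (intro trace_cong) (auto simp: br'_def pP p(3))
      also have "\<dots> = 0" using N(2) x \<open>P \<subseteq> N\<close> p(2) by blast
      finally show ?thesis .
    qed
  qed
  then have "P = {0}" using subspace_0[OF PD(1)] by blast
  then show ?thesis using P_def by blast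
qed

lemma killing_form_nondegenerate:
  assumes "x \<in> T" "\<And>y. y \<in> T \<Longrightarrow> killing_form x y = 0"
  shows "x = 0"
proof -
  have "lts_ideal T" using br_closed by (intro lts_idealI subspace_carr) auto
  from lts_ideal_orthogonal[OF this] have N: "lts_ideal {x \<in> T. \<forall>y\<in>T. killing_form x y = 0}" .
  from derived_orthogonal_trivial[OF this] have "solvable_ideal {x \<in> T. \<forall>y\<in>T. killing_form x y = 0}"
    using N by (auto simp: solvable_ideal_def)
  from solvable_ideal_trivial[OF this] show ?thesis using assms by auto
qed

lemma killing_form_represents:
  assumes "\<And>x y. x \<in> T \<Longrightarrow> y \<in> T \<Longrightarrow> f (x + y) = f x + f y"
    and "\<And>c x. x \<in> T \<Longrightarrow> f (scale c x) = c * f x"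
  shows "\<exists>t\<in>T. \<forall>x\<in>T. killing_form t x = f x"
proof -
  have BT: "b \<in> T" if "b \<in> B" for b using that span_base span_B by blast
  \<comment> \<open>Stated for arbitrary \<open>f\<close> because two functionals occur: the zero
    functional, to pass from vanishing on \<open>B\<close> to nondegeneracy, and the given
    one.\<close>
  have linear_eq: "killing_form t x = f x" if "t \<in> T" "\<And>b. b \<in> B \<Longrightarrow> killing_form t b = f b" "x \<in> span B"
    and f: "\<And>x y. x \<in> T \<Longrightarrow> y \<in> T \<Longrightarrow> f (x + y) = f x + f y"
      "\<And>c x. x \<in> T \<Longrightarrow> f (scale c x) = c * f x" for t x f
  proof -
    have f0: "f 0 = 0" using f(2)[of 0 0] by (simp add: carr_closed)
    have t0: "killing_form t 0 = 0"
      using killing_form_scale[of 0 t 0] acting_pair_T[of 0 t] that(1) by (simp add: carr_closed killing_form_sym[of t])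
    from that(3) have "x \<in> T \<and> killing_form t x = f x"
    proof (induction rule: span_induct_alt)
      case base
      show ?case by (simp add: f0 t0 carr_closed)
    next
      case (step c x y)
      have "killing_form (scale c x + y) t = c * killing_form x t + killing_form y t"
        using step BT that(1) by (simp add: killing_form_add killing_form_scale acting_pair_T carr_closed)
      then show ?case
        using step BT that(2)[of x] by (simp add: killing_form_sym[of t] f carr_closed)
    qed
    then show ?thesis by simp
  qed
  have "\<exists>t\<in>span B. \<forall>b\<in>B. killing_form t b = f b"
  proof (rule nondegenerate_form_represents[OF finite_B indep_B])
    fix x assume x: "x \<in> span B" "\<And>b. b \<in> B \<Longrightarrow> killing_form x b = 0"
    have "killing_form x y = 0" if "y \<in> T" for y
      using linear_eq[of x "\<lambda>_. 0" y] x that by (simp add: span_B)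
    then show "x = 0" using x(1) by (intro killing_form_nondegenerate) (simp_all add: span_B)
  qed (simp_all add: span_B BT killing_form_add killing_form_scale acting_pair_T)
  then show ?thesis using linear_eq[OF _ _ _ assms] span_B by blast
qed

text \<open>\<open>t\<close> represents a functional that is 0 on \<open>I\<close> but not on T, so
  it is a nonzero element of the orthogonal ideal \<open>J\<close>. The ideal
  \<open>I \<inter> J\<close> is solvable, hence 0, and brackets of \<open>t\<close> with
  \<open>I\<close> fall into it.\<close>

lemma proper_ideal_centralizer:
  assumes I: "lts_ideal I" and "I \<noteq> T"
  obtains t where "t \<in> T" "t \<noteq> 0" "\<And>i x. i \<in> I \<Longrightarrow> x \<in> T \<Longrightarrow> br t i x = 0 \<and> br t x i = 0"
proof -
  note ID = lts_idealD[OF I]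
  obtain v where v: "v \<in> T" "v \<notin> I" using ID(2) \<open>I \<noteq> T\<close> by blast
  obtain f where f: "Vector_Spaces.linear scale (*) f" "\<And>x. x \<in> I \<Longrightarrow> f x = 0" "f v = 1"
    using separating_functional[OF ID(1) v(2)] by blast
  interpret f: Vector_Spaces.linear scale "(*)" f by (rule f(1))
  obtain t where t: "t \<in> T" "\<And>x. x \<in> T \<Longrightarrow> killing_form t x = f x"
    using killing_form_represents[of f] f.add f.scale by blast
  define J where "J = {x \<in> T. \<forall>y\<in>I. killing_form x y = 0}"
  have J: "lts_ideal J" unfolding J_def by (rule lts_ideal_orthogonal[OF I])
  note JD = lts_idealD[OF J]
  have K: "lts_ideal (I \<inter> J)"
    using ID JD by (intro lts_idealI subspace_inter) auto
  \<comment> \<open>\<open>[x,a,-]\<close> is skew for the form and maps T into \<open>I\<close>, to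
    which \<open>b\<close> is orthogonal.\<close>
  have "br x a b = 0" if x: "x \<in> T" and a: "a \<in> I \<inter> J" and b: "b \<in> I \<inter> J" for x a b
  proof (rule killing_form_nondegenerate)
    have abT: "a \<in> T" "b \<in> T" using a b ID(2) by auto
    show "br x a b \<in> T" using x abT by (rule br_closed)
    fix y assume y: "y \<in> T"
    have "killing_form (br x a b) y + killing_form b (br x a y) = 0"
      using x y abT by (intro killing_form_derivation acting_pair_T br_closed)
    moreover have "br x a y \<in> I" using a x y ID(4) by simp
    then have "killing_form b (br x a y) = 0" using b by (simp add: J_def)
    ultimately show "killing_form (br x a b) y = 0" by simp
  qed
  then have "bracket T (I \<inter> J) (I \<inter> J) \<subseteq> {0}" by (intro bracket_subset) auto
  then have "derived (I \<inter> J) 1 = {0}"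
    using subspace_0[OF subspace_bracket[of T "I \<inter> J" "I \<inter> J"]] by auto
  then have "solvable_ideal (I \<inter> J)" using K unfolding solvable_ideal_def by blast
  then have IJ: "I \<inter> J = {0}" by (rule solvable_ideal_trivial)
  have "killing_form 0 v = 0" using killing_form_scale[of 0 v 0] acting_pair_T[of 0 v] v(1) by (simp add: carr_closed)
  then have "t \<noteq> 0" using t(2)[OF v(1)] f(3) by auto
  moreover have "t \<in> J" using t f(2) ID(2) by (auto simp: J_def)
  have "br t i x = 0 \<and> br t x i = 0" if "i \<in> I" "x \<in> T" for i x
  proof -
    have "i \<in> T" using that(1) ID(2) by blast
    then have "br t i x \<in> I \<inter> J" "br t x i \<in> I \<inter> J"
      using ID(4,5)[OF that(1) t(1) that(2)] JD(3)[OF \<open>t \<in> J\<close>] that(2) by auto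
    then show ?thesis using IJ by simp
  qed
  ultimately show thesis using that t(1) by blast
qed

end

subsection \<open>Systems of quotients\<close>

context lie_triple_system
begin

lemma subsystemD:
  assumes "subsystem T"
  shows "subspace T" "T \<subseteq> carr"
    "\<lbrakk>x \<in> T; y \<in> T; z \<in> T\<rbrakk> \<Longrightarrow> br x y z \<in> T"
  using assms bracketI[of x T y T z T] by (auto simp: subsystem_def)

context
  fixes T s
  assumes T: "subsystem T" and s: "s \<in> carr"
begin

lemma R_span_base: "s \<in> R_span T s"
  unfolding R_span_def by (rule span_base) (auto intro: exI[of _ "[]"])

lemma R_span_step:
  assumes "m \<in> R_span T s" "x \<in> T" "y \<in> T"
  shows "m \<in> carr \<and> br m x y \<in> R_span T s"
proof -
  have xy: "x \<in> carr" "y \<in> carr" using assms subsystemD(2)[OF T] by auto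
  from assms(1) show ?thesis
    unfolding R_span_def
  proof (induction rule: span_induct_alt)
    case base
    show ?case using xy by (simp add: carr_closed bracket_zero span_zero)
  next
    case (step c m m')
    then obtain ps where ps: "m = foldr (\<lambda>(x, y). R x y) ps s" "set ps \<subseteq> T \<times> T" by blast
    have "foldr (\<lambda>(x, y). R x y) ps s \<in> carr" if "set ps \<subseteq> T \<times> T" for ps
      using that by (induction ps) (use s subsystemD(2)[OF T] in \<open>auto simp: R_def intro!: br_closed\<close>)
    then have m: "m \<in> carr" using ps by simp
    have "br m x y = foldr (\<lambda>(x, y). R x y) ((x, y) # ps) s" by (simp add: ps(1) R_def)
    moreover have "set ((x, y) # ps) \<subseteq> T \<times> T" using ps(2) assms by auto
    ultimately have "br m x y \<in> span {foldr (\<lambda>(x, y). R x y) ps s | ps. set ps \<subseteq> T \<times> T}"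
      by (intro span_base) blast
    moreover have "br (scale c m + m') x y = scale c (br m x y) + br m' x y"
      using m step.IH xy by (simp add: br_add1 br_scale1 carr_closed)
    ultimately show ?case
      using m step.IH by (auto simp: carr_closed intro!: span_add span_scale)
  qed
qed

text \<open>Generators suffice because T is a subspace; conversely, adding 0 from the other summand
  isolates each bracket.\<close>

lemma colon_iff:
  "x \<in> colon T s \<longleftrightarrow>
    x \<in> T \<and> (\<forall>t\<in>T. \<forall>m\<in>R_span T s. br x t m \<in> T \<and> br x m t \<in> T)" (is "_ \<longleftrightarrow> ?R")
proof
  assume x: "x \<in> colon T s"
  have "br x t m \<in> T \<and> br x m t \<in> T" if tm: "t \<in> T" "m \<in> R_span T s" for t m
  proof -
    have 0: "0 \<in> bracket A B C" for A B C by (rule subspace_0[OF subspace_bracket])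
    have "br x t m + 0 \<in> bracket {x} T (R_span T s) + bracket {x} (R_span T s) T"
      "0 + br x m t \<in> bracket {x} T (R_span T s) + bracket {x} (R_span T s) T"
      using tm by (intro set_plus_intro bracketI 0; simp)+
    then show ?thesis using x by (auto simp: colon_def)
  qed
  then show ?R using x by (simp add: colon_def)
next
  assume R: ?R
  have "bracket {x} T (R_span T s) \<subseteq> T" "bracket {x} (R_span T s) T \<subseteq> T"
    by (rule bracket_subset[OF subsystemD(1)[OF T]]; use R in blast)+
  then have "bracket {x} T (R_span T s) + bracket {x} (R_span T s) T \<subseteq> T"
    using subspace_add[OF subsystemD(1)[OF T]] by (auto simp: set_plus_def)
  then show "x \<in> colon T s" using R by (simp add: colon_def)
qed

lemma subspace_colon: "subspace (colon T s)"
proof (rule subspaceI)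
  have carr: "t \<in> T \<Longrightarrow> t \<in> carr" "t \<in> T \<Longrightarrow> m \<in> R_span T s \<Longrightarrow> m \<in> carr" for t m
    using subsystemD(2)[OF T] R_span_step[of m t t] by auto
  show "0 \<in> colon T s"
    using subspace_0[OF subsystemD(1)[OF T]] by (auto simp: colon_iff bracket_zero carr)
  fix x assume x: "x \<in> colon T s"
  then show "scale c x \<in> colon T s" for c
    using subspace_scale[OF subsystemD(1)[OF T]] by (auto simp: colon_iff br_scale1 carr)
  fix y assume "y \<in> colon T s"
  with x show "x + y \<in> colon T s"
    using subspace_add[OF subsystemD(1)[OF T]] by (auto simp: colon_iff br_add1 carr)
qed

text \<open>Expand \<open>[m, b, [x, a, c]]\<close> and \<open>[x, a, [b, m, c]]\<close> by the derivation identity, modulo \<open>T\<close>.\<close>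

lemma br_colon:
  assumes x: "x \<in> colon T s" and a: "a \<in> T" and b: "b \<in> T"
  shows "br x a b \<in> colon T s"
proof -
  note T = subsystemD[OF T]
  let ?M = "R_span T s"
  have inT: "t \<in> carr" if "t \<in> T" for t using that T(2) by blast
  have inM: "m \<in> carr" if "m \<in> ?M" for m using R_span_step[OF that a a] by simp
  have xT: "x \<in> T" and xtm: "\<And>t m. t \<in> T \<Longrightarrow> m \<in> ?M \<Longrightarrow> br x t m \<in> T"
    and xmt: "\<And>t m. t \<in> T \<Longrightarrow> m \<in> ?M \<Longrightarrow> br x m t \<in> T"
    using x by (auto simp: colon_iff)
  have mtt: "br m t u \<in> ?M" if "m \<in> ?M" "t \<in> T" "u \<in> T" for m t u
    using R_span_step[OF that] by simp
  have tmt: "br t m u \<in> ?M" if "m \<in> ?M" "t \<in> T" "u \<in> T" for m t u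
    using mtt[OF that] bracket_swap[of m t u] that inM inT
    by (simp add: R_span_def span_neg)
  have bmw: "br b m (br x a c) \<in> T" if m: "m \<in> ?M" and b: "b \<in> T" and c: "c \<in> T" for m b c
  proof -
    note carr = inT[OF xT] inT[OF a] inT[OF b] inT[OF c] inM[OF m]
    \<comment> \<open>Rotation expresses \<open>[m,b,x]\<close> by brackets with \<open>x\<close> in
      front, which the colon controls.\<close>
    have mbx: "br m b x \<in> T"
      using bracket_rotate[of m b x] carr subspace_diff[OF T(1) xtm[OF b m] xmt[OF b m]] by simp
    have "br m b (br x a c) = br (br m b x) a c + br x (br m b a) c + br x a (br m b c)"
      using carr by (intro br_derivation)
    also have "\<dots> \<in> T"
      by (intro subspace_add T(1) T(3) mbx a c xmt xtm mtt m b)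
    finally have "br m b (br x a c) \<in> T" .
    then show ?thesis
      using bracket_swap[of m b "br x a c"] carr subspace_neg[OF T(1)] by (simp add: br_closed)
  qed
  have G: "br (br x a b) m c \<in> T" if m: "m \<in> ?M" and b: "b \<in> T" and c: "c \<in> T" for m b c
  proof -
    note carr = inT[OF xT] inT[OF a] inT[OF b] inT[OF c] inM[OF m]
    have "br x a (br b m c) = br (br x a b) m c + br b (br x a m) c + br b m (br x a c)"
      using carr by (intro br_derivation)
    then have "br (br x a b) m c = br x a (br b m c) - br b (br x a m) c - br b m (br x a c)"
      by (simp add: algebra_simps)
    also have "\<dots> \<in> T"
      by (intro subspace_diff T(1) T(3) bmw xtm tmt a b c m)
    finally show ?thesis .
  qed
  \<comment> \<open>The remaining position of \<open>m\<close> follows from the two previous facts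
    by the cyclic identity.\<close>
  have "br (br x a b) c m \<in> T" if m: "m \<in> ?M" and c: "c \<in> T" for m c
  proof -
    note carr = inT[OF xT] inT[OF a] inT[OF b] inT[OF c] inM[OF m]
    have "br c m (br x a b) = br (br x a b) m c - br (br x a b) c m"
      using carr by (intro bracket_rotate br_closed)
    then have "br (br x a b) c m = br (br x a b) m c - br c m (br x a b)"
      by (simp add: algebra_simps)
    then show ?thesis using subspace_diff[OF T(1) G[OF m b c] bmw[OF m c b]] by simp
  qed
  then show ?thesis using G b T(3)[OF xT a b] by (simp add: colon_iff)
qed

end

end

section \<open>Quotient elements are represented inside T\<close>

theorem proposition3p21:
  fixes scale :: "'k::{alg_closed_field, field_char_0} \<Rightarrow> 'v::ab_group_add \<Rightarrow> 'v"
    and T S :: "'v set"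
    and brT brS :: "'v \<Rightarrow> 'v \<Rightarrow> 'v \<Rightarrow> 'v"
  assumes "lie_triple_system scale T brT"
    and "lie_triple_system.finite_dimensional scale T"
    and "lie_triple_system.semisimple scale T brT"
    and "maximal_system_of_quotients scale T brT S brS"
  shows "S = T"
proof -
  interpret T: lie_triple_system scale T brT by fact
  have quot: "system_of_quotients scale T brT S brS"
    using assms(4) by (simp add: maximal_system_of_quotients_def)
  interpret S: lie_triple_system scale S brS
    using quot by (simp add: system_of_quotients_def)
  have sub: "S.subsystem T" and agree: "\<And>x y z. x \<in> T \<Longrightarrow> y \<in> T \<Longrightarrow> z \<in> T \<Longrightarrow> brS x y z = brT x y z"
    using quot by (auto simp: system_of_quotients_def)
  have quotD: "\<exists>x\<in>T. \<exists>y\<in>T. brS s x y \<noteq> 0 \<and> (x \<in> S.colon T s' \<or> y \<in> S.colon T s')"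
    if "s \<in> S" "s' \<in> S" "s \<noteq> 0" for s s'
    using quot that by (simp add: system_of_quotients_def)
  note TS = S.subsystemD[OF sub]
  obtain B0 where B0: "finite B0" "T.span B0 = T"
    using assms(2) by (auto simp: T.finite_dimensional_def)
  obtain B where B: "B \<subseteq> B0" "T.independent B" "B0 \<subseteq> T.span B"
    using T.maximal_independent_subset[of B0] by blast
  have span_B: "T.span B = T"
    using B(1,3) B0(2) by (metis T.span_eq T.span_superset subset_trans)
  interpret T: semisimple_lts scale T brT B
    by unfold_locales (use assms(3) B B0 span_B finite_subset in auto)
  interpret S: lts_over scale S brS B
    by unfold_locales (use TS B B0 span_B finite_subset in auto)
  have killing_form_eq: "S.killing_form x y = T.killing_form x y" if "x \<in> T" "y \<in> T" for x y
    unfolding S.killing_form_def T.killing_form_def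
    using that T.span_superset[of B] span_B by (intro T.trace_cong) (auto simp: agree)
  have colon: "S.colon T s = T" if s: "s \<in> S" for s
  proof (rule ccontr)
    assume neq: "S.colon T s \<noteq> T"
    have cT: "S.colon T s \<subseteq> T" by (auto simp: S.colon_def)
    have "T.lts_ideal (S.colon T s)"
    proof (rule T.lts_idealI[OF S.subspace_colon[OF sub s] cT])
      fix x a b assume xab: "x \<in> S.colon T s" "a \<in> T" "b \<in> T"
      then have "x \<in> T" using cT by blast
      then show "brT x a b \<in> S.colon T s"
        using S.br_colon[OF sub s xab] agree xab by simp
    qed
    then obtain t where t: "t \<in> T" "t \<noteq> 0"
      "\<And>i x. i \<in> S.colon T s \<Longrightarrow> x \<in> T \<Longrightarrow> brT t i x = 0 \<and> brT t x i = 0"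
      using T.proper_ideal_centralizer[OF _ neq] by metis
    \<comment> \<open>The quotient condition for \<open>t\<close> and \<open>s\<close> puts
      \<open>x\<close> or \<open>y\<close> into the colon, and in either place the colon is
      annihilated by \<open>t\<close>.\<close>
    obtain x y where xy: "x \<in> T" "y \<in> T" "brS t x y \<noteq> 0" "x \<in> S.colon T s \<or> y \<in> S.colon T s"
      using quotD[of t s] t TS(2) s by blast
    then show False using t(3)[of x y] t(3)[of y x] t(1) agree[of t x y] by auto
  qed
  have acts: "S.acts s" if s: "s \<in> S" for s
  proof -
    \<comment> \<open>\<open>s\<close> itself belongs to \<open>R_span T s\<close>, and every
      \<open>x\<close> in T is now in the colon.\<close>
    have "brS x t s \<in> T \<and> brS x s t \<in> T" if "x \<in> T" "t \<in> T" for x t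
      using that S.colon_iff[OF sub s, of x] S.R_span_base[OF sub s] colon[OF s] by blast
    moreover from this have "brS s x y \<in> T" if "x \<in> T" "y \<in> T" for x y
      using S.bracket_swap[of x s y] that TS(2) s T.subspace_neg[OF TS(1)] by (auto simp: subset_iff)
    ultimately show ?thesis using s by (simp add: S.acts_def span_B)
  qed
  have "s \<in> T" if s: "s \<in> S" for s
  proof -
    have pair: "S.acting_pair u x" if "u \<in> S" "x \<in> T" for u x
      using acts[OF that(1)] that(2) by (simp add: S.acting_pair_def span_B)
    have "\<exists>t\<in>T. \<forall>x\<in>T. T.killing_form t x = S.killing_form x s"
    proof (rule T.killing_form_represents)
      have pair': "S.acting_pair x s" if "x \<in> T" for x
        using acts[OF s] that by (simp add: S.acting_pair_def span_B)
      show "S.killing_form (x + y) s = S.killing_form x s + S.killing_form y s" if "x \<in> T" "y \<in> T" for x y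
        using that by (intro S.killing_form_add pair')
      show "S.killing_form (scale c x) s = c * S.killing_form x s" if "x \<in> T" for c x
        using that by (intro S.killing_form_scale pair')
    qed
    then obtain t where t: "t \<in> T" "\<And>x. x \<in> T \<Longrightarrow> T.killing_form t x = S.killing_form s x"
      using S.killing_form_sym by auto
    define e where "e = s - t"
    have tS: "t \<in> S" using t(1) TS(2) by blast
    have e: "e \<in> S" using s tS by (simp add: e_def S.carr_closed)
    have "e + t = s" by (simp add: e_def)
    then have killing_form_e: "S.killing_form e x = 0" if "x \<in> T" for x
      using S.killing_form_add[OF pair[OF e that] pair[OF tS that]] t(2)[OF that] killing_form_eq[OF t(1) that] by simp
    \<comment> \<open>Nondegeneracy is available on T only. It cannot be applied to \<open>e\<close>
      directly, but it applies to \<open>[e,x,y]\<close>, which lies in T because \<open>e\<close>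
      acts.\<close>
    have e0: "brS e x y = 0" if xy: "x \<in> T" "y \<in> T" for x y
    proof (rule T.killing_form_nondegenerate)
      show exy: "brS e x y \<in> T" using S.acts_br(1)[OF acts[OF e], of x y] xy by (simp add: span_B)
      fix z assume z: "z \<in> T"
      have "S.killing_form (brS e x y) z = S.killing_form e (brS z y x)"
        using xy z by (intro S.killing_form_invariant acts e) (simp_all add: span_B)
      also have "\<dots> = 0" using TS(3)[OF z xy(2,1)] by (rule killing_form_e)
      finally show "T.killing_form (brS e x y) z = 0" using killing_form_eq[OF exy z] by simp
    qed
    have "e = 0" using quotD[OF e e] e0 by blast
    then show "s \<in> T" using t(1) by (simp add: e_def)
  qed
  with TS(2) show "S = T" by blast
qed

end
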